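(* Let $M$ be a matroid on a finite ground set $E$. Then $$2-\frac{2}{\mathrm{c}(M)}\le \widehat{\rho}(I(M))\le \frac{\mathrm{rk}(M)\,\mathrm{c}(M^* )}{\mathrm{rk}(M)+\mathrm{c}(M^* )-1}.$$
   Context: $M^*$ denotes the dual matroid of $M$ and $\mathrm{rk}(M)$ its rank. The circumference $\mathrm{c}(N)$ of a matroid $N$ is the maximum size of a circuit of $N$ (it is understood that the circumferences appearing are defined, i.e. the matroids in question have at least one circuit; $M^*$ has a circuit exactly when $\mathrm{rk}(M)\geq 1$). Standing assumption: $\mathrm{rk}(M)<|E|$ (so $M$ has a circuit). Let $\mathbb{K}$ be a field. For a matroid $M$ on a finite ground set $E$, let $S=\mathbb{K}[x_e : e\in E]$ and define the facet ideal $I(M)=\langle \prod_{e\in B}x_e : B \text{ a basis of } M\rangle\subset S$. For a squarefree monomial ideal $I\subset S$, the $s$-th symbolic power is $I^{(s)}=\bigcap_{P\in \mathrm{Min}(I)}P^s$, where $\mathrm{Min}(I)$ is the set of minimal primes of $I$. The asymptotic resurgence is $\widehat{\rho}(I)=\sup\{s/r : s,r \text{ positive integers},\ I^{(st)}\not\subset I^{rt}\text{ for all } t\gg 0\}$. *)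

theory Defs
  imports
    "HOL-Algebra.Ideal_Product"
    "HOL-Library.Poly_Mapping"
    "HOL-Library.Extended_Real"
begin

section \<open>Matroids\<close>

locale matroid =
  fixes E :: "'e set" and indep :: "'e set \<Rightarrow> bool"
  assumes finite_ground: "finite E"
    and indep_ground: "indep X \<Longrightarrow> X \<subseteq> E"
    and indep_empty: "indep {}"
    and indep_subset: "indep Y \<Longrightarrow> X \<subseteq> Y \<Longrightarrow> indep X"
    and augment: "indep X \<Longrightarrow> indep Y \<Longrightarrow> card X < card Y \<Longrightarrow> \<exists>y\<in>Y - X. indep (insert y X)"

definition basis :: "'e set \<Rightarrow> ('e set \<Rightarrow> bool) \<Rightarrow> 'e set \<Rightarrow> bool" where
  "basis E indep B \<longleftrightarrow> B \<subseteq> E \<and> indep B \<and> (\<forall>X. X \<subseteq> E \<and> indep X \<and> B \<subseteq> X \<longrightarrow> X = B)"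

definition circuit :: "'e set \<Rightarrow> ('e set \<Rightarrow> bool) \<Rightarrow> 'e set \<Rightarrow> bool" where
  "circuit E indep C \<longleftrightarrow> C \<subseteq> E \<and> \<not> indep C \<and> (\<forall>X. X \<subset> C \<longrightarrow> indep X)"

definition matroid_rank :: "'e set \<Rightarrow> ('e set \<Rightarrow> bool) \<Rightarrow> nat" where
  "matroid_rank E indep = Max (card ` {X. X \<subseteq> E \<and> indep X})"

text \<open>Only meaningful if there is at least one circuit.\<close>

definition circumference :: "'e set \<Rightarrow> ('e set \<Rightarrow> bool) \<Rightarrow> nat" where
  "circumference E indep = Max (card ` {C. circuit E indep C})"

text \<open>The bases of the dual matroid are the complements of the bases.\<close>

definition dual_indep :: "'e set \<Rightarrow> ('e set \<Rightarrow> bool) \<Rightarrow> 'e set \<Rightarrow> bool" where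
  "dual_indep E indep X \<longleftrightarrow> (\<exists>B. basis E indep B \<and> X \<subseteq> E - B)"


section \<open>Polynomial rings\<close>

text \<open>
  A polynomial maps exponent vectors to coefficients, both finitely supported.  The polynomial
  ring in the variables indexed by \<open>E\<close> consists of those polynomials all of whose
  monomials are supported on \<open>E\<close>.
\<close>

type_synonym ('e, 'k) mpoly = "('e \<Rightarrow>\<^sub>0 nat) \<Rightarrow>\<^sub>0 'k"

definition poly_ring :: "'e set \<Rightarrow> ('e, 'k::field) mpoly ring" where
  "poly_ring E =
     \<lparr> carrier = {p. \<forall>m\<in>Poly_Mapping.keys p. Poly_Mapping.keys m \<subseteq> E},
       mult = (*), one = 1, zero = 0, add = (+) \<rparr>"

definition poly_var :: "'e \<Rightarrow> ('e, 'k::field) mpoly" where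
  "poly_var e = Poly_Mapping.single (Poly_Mapping.single e 1) 1"

lemma poly_ring_cring: "cring (poly_ring E :: ('e, 'k::field) mpoly ring)"
proof (rule cringI)
  let ?R = "poly_ring E :: ('e, 'k) mpoly ring"
  show "abelian_group ?R"
  proof (rule abelian_groupI)
    fix x y assume "x \<in> carrier ?R" "y \<in> carrier ?R"
    then show "x \<oplus>\<^bsub>?R\<^esub> y \<in> carrier ?R"
      using Poly_Mapping.keys_add[of x y] by (auto simp: poly_ring_def)
  next
    fix x assume "x \<in> carrier ?R"
    then show "\<exists>y\<in>carrier ?R. y \<oplus>\<^bsub>?R\<^esub> x = \<zero>\<^bsub>?R\<^esub>"
      by (intro bexI[of _ "- x"]) (auto simp: poly_ring_def)
  qed (auto simp: poly_ring_def algebra_simps)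
  show "comm_monoid ?R"
  proof (rule comm_monoidI)
    fix x y assume xy: "x \<in> carrier ?R" "y \<in> carrier ?R"
    have "Poly_Mapping.keys m \<subseteq> E" if m: "m \<in> Poly_Mapping.keys (x * y)" for m
    proof -
      obtain a b where "m = a + b" "a \<in> Poly_Mapping.keys x" "b \<in> Poly_Mapping.keys y"
        using m Poly_Mapping.keys_mult[of x y] by blast
      then show ?thesis
        using xy Poly_Mapping.keys_add[of a b] by (fastforce simp: poly_ring_def)
    qed
    then show "x \<otimes>\<^bsub>?R\<^esub> y \<in> carrier ?R"
      by (auto simp: poly_ring_def)
  qed (auto simp: poly_ring_def algebra_simps)
qed (auto simp: poly_ring_def algebra_simps)


section \<open>Symbolic powers and asymptotic resurgence\<close>

text \<open>
  The power of an ideal is the power \<^term>\<open>I [^]\<^bsub>ideals_set R\<^esub> n\<close> in the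
  multiplicative monoid of ideals of \<^term>\<open>R\<close>.
\<close>

definition minimal_primes :: "('a, 'b) ring_scheme \<Rightarrow> 'a set \<Rightarrow> 'a set set" where
  "minimal_primes R I =
     {P. primeideal P R \<and> I \<subseteq> P \<and> (\<forall>Q. primeideal Q R \<and> I \<subseteq> Q \<and> Q \<subseteq> P \<longrightarrow> Q = P)}"

text \<open>
  This is the definition for squarefree monomial ideals; for general ideals the powers of the
  minimal primes have to be replaced by their localisations.  The intersection is taken inside
  the ring.
\<close>

definition symbolic_power ::
    "('a, 'b) ring_scheme \<Rightarrow> 'a set \<Rightarrow> nat \<Rightarrow> 'a set" where
  "symbolic_power R I s =
     carrier R \<inter> (\<Inter>P\<in>minimal_primes R I. P [^]\<^bsub>ideals_set R\<^esub> s)"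

text \<open>The supremum is taken in the extended reals, so that it exists unconditionally.\<close>

definition asymptotic_resurgence :: "('a, 'b) ring_scheme \<Rightarrow> 'a set \<Rightarrow> ereal" where
  "asymptotic_resurgence R I =
     Sup {ereal (real s / real r) | s r. 0 < s \<and> 0 < r \<and>
       (\<forall>\<^sub>F t in sequentially.
          \<not> symbolic_power R I (s * t) \<subseteq> I [^]\<^bsub>ideals_set R\<^esub> (r * t))}"

definition facet_ideal ::
    "'e set \<Rightarrow> ('e set \<Rightarrow> bool) \<Rightarrow> ('e, 'k::field) mpoly set" where
  "facet_ideal E indep = Idl\<^bsub>poly_ring E\<^esub> {\<Prod>e\<in>B. poly_var e | B. basis E indep B}"

end

theory Submission
  imports Defs
begin

text \<open>
  Write \<open>k\<close> for the rank, \<open>c\<close> for the largest size of a cocircuit and \<open>I\<close> for the facet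
  ideal.  All ideals involved are spanned by monomials, and both bounds become statements about
  exponents, that is, about weights on the ground set.
  
  The minimal primes of \<open>I\<close> are generated by the variables in the minimal sets meeting every basis,
  which are the cocircuits.  Hence a monomial lies in the symbolic power of order \<open>s\<close> iff its
  exponent gives every cocircuit total weight at least \<open>s\<close>; it lies in \<open>I\<close> to the power
  \<open>r\<close> iff \<open>r\<close> bases can be packed into its exponent.  By Edmonds' packing theorem
  (\<open>base_packing\<close>, derived from \<open>submodular_transversal\<close>) the latter means that outside any set
  \<open>A\<close> the weight is at least \<open>r\<close> times the rank of the contraction \<open>M / A\<close>.
  
  Upper bound: contracting heavy elements of cocircuits one by one shows that a weight with at
  least \<open>s\<close> on every cocircuit has at least \<open>s (k' + c - 1) / c\<close> outside \<open>A\<close>, where \<open>k' > 0\<close>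
  is the rank of \<open>M / A\<close> (\<open>cocircuit_cover_bound\<close>).  Since \<open>k' \<le> k\<close>, this is at least
  \<open>r k'\<close> as soon as \<open>s / r \<ge> k c / (k + c - 1)\<close>, so beyond that ratio the symbolic power is
  always contained in the ordinary one (\<open>symbolic_power_subset_pow\<close>).
  
  Lower bound: let \<open>C\<close> be a circuit with \<open>n\<close> elements, as large as possible, and contract a set
  \<open>A\<close> skew to \<open>C\<close> such that \<open>C\<close> becomes spanning.  Every cocircuit avoiding \<open>A\<close> meets \<open>C\<close>
  in at least two elements, so weight \<open>s / 2\<close> on \<open>C\<close> and \<open>s\<close> on \<open>A\<close> suffices for
  the symbolic power, while packing \<open>r\<close> bases needs weight \<open>r (n - 1)\<close> on \<open>C\<close>.  Thus, up to
  the rounding of \<open>s / 2\<close>, which does not matter for large multiples of \<open>s\<close> and \<open>r\<close>, every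
  ratio \<open>s / r < 2 (n - 1) / n\<close> prevents containment
  (\<open>symbolic_power_not_subset_pow_circuit\<close>).
\<close>

section \<open>Independent transversals\<close>

text \<open>
  Welsh's form of Rado's theorem on independent transversals.  The reason is that a set \<open>A i\<close>
  with two distinct elements \<open>a\<close>, \<open>b\<close> can always lose one of them without destroying the Hall
  condition: if removing \<open>a\<close> made a family \<open>L\<close> together with \<open>i\<close> too poor, and removing \<open>b\<close>
  did so for \<open>M\<close>, then submodularity would make \<open>L \<union> M\<close> together with \<open>i\<close>, or
  \<open>L \<inter> M\<close>, violate the condition.  Shrinking stops at singletons.
  A constant summand in \<open>f\<close> plays the role of a defect.
\<close>

lemma submodular_transversal:
  fixes f :: "'a set \<Rightarrow> nat" and A :: "'j \<Rightarrow> 'a set"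
  assumes fin: "finite J"
    and mono: "\<And>X Y. X \<subseteq> Y \<Longrightarrow> f X \<le> f Y"
    and submod: "\<And>X Y. f (X \<union> Y) + f (X \<inter> Y) \<le> f X + f Y"
    and "\<And>j. j \<in> J \<Longrightarrow> finite (A j)" and "\<And>j. j \<in> J \<Longrightarrow> A j \<noteq> {}"
    and "\<And>K. K \<subseteq> J \<Longrightarrow> card K \<le> f (\<Union>(A ` K))"
  shows "\<exists>x. (\<forall>j\<in>J. x j \<in> A j) \<and> card J \<le> f (x ` J)"
  using assms(4-6)
proof (induction "\<Sum>j\<in>J. card (A j)" arbitrary: A rule: less_induct)
  case less
  show ?case
  proof (cases "\<forall>j\<in>J. \<exists>y. A j = {y}")
    case True
    then obtain x where x: "\<And>j. j \<in> J \<Longrightarrow> A j = {x j}" by metis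
    then have "\<Union>(A ` J) = x ` J" by auto
    with less.prems(3)[of J] x show ?thesis by (intro exI[of _ x]) auto
  next
    case False
    then obtain i where i: "i \<in> J" "\<nexists>y. A i = {y}" by blast
    from less.prems(2)[OF i(1)] obtain a where a: "a \<in> A i" by blast
    with i(2) obtain b where b: "b \<in> A i" "b \<noteq> a" by blast
    \<comment> \<open>Removing \<open>c\<close> either keeps the Hall condition, and induction applies, or yields a
      family \<open>L\<close> which is tight together with what is left of \<open>A i\<close>.\<close>
    have shrink: "?thesis \<or> (\<exists>L\<subseteq>J - {i}. f ((A i - {c}) \<union> \<Union>(A ` L)) \<le> card L)"
      if c: "c \<in> A i" "A i \<noteq> {c}" for c
    proof (cases "\<forall>K\<subseteq>J. card K \<le> f (\<Union>((A(i := A i - {c})) ` K))")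
      case True
      let ?A = "A(i := A i - {c})"
      have "card (?A i) < card (A i)"
        using less.prems(1)[OF i(1)] c(1) by (simp add: card_Diff1_less del: card_Diff_insert)
      then have "(\<Sum>j\<in>J. card (?A j)) < (\<Sum>j\<in>J. card (A j))"
        using fin i(1) less.prems(1) by (intro sum_strict_mono_ex1) (auto intro: card_mono)
      moreover have "finite (?A j)" "?A j \<noteq> {}" if "j \<in> J" for j
        using less.prems(1,2)[OF that] c by auto
      ultimately obtain x where x: "\<forall>j\<in>J. x j \<in> ?A j" "card J \<le> f (x ` J)"
        using less.hyps[of ?A] True by blast
      have "\<forall>j\<in>J. x j \<in> A j"
        using x(1) by (metis DiffD1 fun_upd_apply)
      with x(2) show ?thesis by blast
    next
      case False
      then obtain K where K: "K \<subseteq> J" "f (\<Union>((A(i := A i - {c})) ` K)) < card K"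
        by (meson not_le)
      have iK: "i \<in> K"
      proof (rule ccontr)
        assume "i \<notin> K"
        then have "(A(i := A i - {c})) ` K = A ` K" by (intro image_cong) auto
        with K(2) less.prems(3)[OF K(1)] show False by (metis not_le)
      qed
      then have eq: "\<Union>((A(i := A i - {c})) ` K) = (A i - {c}) \<union> \<Union>(A ` (K - {i}))"
        by (auto split: if_splits)
      have "card K = Suc (card (K - {i}))"
        using iK K(1) fin by (metis card.remove finite_subset)
      with K eq show ?thesis by (intro disjI2 exI[of _ "K - {i}"]) auto
    qed
    show ?thesis
    proof (rule ccontr)
      assume n: "\<not> ?thesis"
      have ne: "A i \<noteq> {a}" "A i \<noteq> {b}" using a b by auto
      obtain L where L: "L \<subseteq> J - {i}" "f ((A i - {a}) \<union> \<Union>(A ` L)) \<le> card L"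
        using shrink[OF a ne(1)] n by blast
      obtain M where M: "M \<subseteq> J - {i}" "f ((A i - {b}) \<union> \<Union>(A ` M)) \<le> card M"
        using shrink[OF b(1) ne(2)] n by blast
      let ?X = "(A i - {a}) \<union> \<Union>(A ` L)" and ?Y = "(A i - {b}) \<union> \<Union>(A ` M)"
      have finLM: "finite L" "finite M" using L M fin by (auto intro: finite_subset)
      have "?X \<union> ?Y = \<Union>(A ` insert i (L \<union> M))" using a b by auto
      moreover have "card (insert i (L \<union> M)) \<le> f (\<Union>(A ` insert i (L \<union> M)))"
        using L(1) M(1) i(1) by (intro less.prems(3)) auto
      moreover have "card (insert i (L \<union> M)) = Suc (card (L \<union> M))"
        using L(1) M(1) finLM by (intro card_insert_disjoint) auto
      ultimately have "Suc (card (L \<union> M)) \<le> f (?X \<union> ?Y)" by simp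
      moreover have "card (L \<inter> M) \<le> f (?X \<inter> ?Y)"
      proof -
        have "card (L \<inter> M) \<le> f (\<Union>(A ` (L \<inter> M)))" using L by (intro less.prems(3)) auto
        also have "\<dots> \<le> f (?X \<inter> ?Y)" by (intro mono) auto
        finally show ?thesis .
      qed
      ultimately show False
        using submod[of ?X ?Y] L M card_Un_Int[OF finLM] by linarith
    qed
  qed
qed

section \<open>Rank, cocircuits and packings of bases\<close>

context matroid
begin

definition rk :: "'e set \<Rightarrow> nat" where
  "rk X = Max (card ` {Y. Y \<subseteq> X \<and> indep Y})"

lemma finite_indep: "finite {Y. Y \<subseteq> X \<and> indep Y}"
  using finite_ground indep_ground by (auto intro: finite_subset[of _ "Pow E"])

lemma card_le_rk: "indep Y \<Longrightarrow> Y \<subseteq> X \<Longrightarrow> card Y \<le> rk X"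
  unfolding rk_def using finite_indep by (intro Max_ge) auto

lemma rk_witness: obtains Y where "Y \<subseteq> X" "indep Y" "card Y = rk X"
proof -
  have "rk X \<in> card ` {Y. Y \<subseteq> X \<and> indep Y}"
    unfolding rk_def using finite_indep indep_empty by (intro Max_in) auto
  then show thesis using that by auto
qed

lemma rk_mono: "X \<subseteq> Y \<Longrightarrow> rk X \<le> rk Y"
  by (metis card_le_rk rk_witness subset_trans)

lemma finite_if_indep: "indep X \<Longrightarrow> finite X"
  using finite_ground finite_subset indep_ground by blast

text \<open>
  Repeated augmentation from an independent set of maximal size inside \<open>Z\<close>.
\<close>

lemma extend_indep:
  assumes "indep X" "X \<subseteq> Z"
  obtains Y where "X \<subseteq> Y" "Y \<subseteq> Z" "indep Y" "card Y = rk Z"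
proof -
  have "\<exists>Y. X \<subseteq> Y \<and> Y \<subseteq> Z \<and> indep Y \<and> card Y = rk Z"
    using assms
  proof (induction "rk Z - card X" arbitrary: X)
    case 0
    then show ?case using card_le_rk[of X Z] by (intro exI[of _ X]) auto
  next
    case (Suc n)
    obtain W where W: "W \<subseteq> Z" "indep W" "card W = rk Z" by (rule rk_witness)
    with Suc.hyps(2) have "\<exists>y\<in>W - X. indep (insert y X)"
      by (intro augment[OF Suc.prems(1)]) auto
    then obtain y where y: "y \<in> W - X" "indep (insert y X)" by blast
    then have "n = rk Z - card (insert y X)"
      using Suc.hyps(2) finite_if_indep[OF Suc.prems(1)] by simp
    from Suc.hyps(1)[OF this y(2)] y(1) W(1) Suc.prems(2) show ?case by blast
  qed
  then show thesis using that by blast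
qed

text \<open>
  A maximal independent subset of \<open>X \<inter> Y\<close> extends to a maximal one of \<open>X \<union> Y\<close>; the traces of
  the latter on \<open>X\<close> and on \<open>Y\<close> are independent and overlap at least in the former.
\<close>

lemma rk_submodular: "rk (X \<union> Y) + rk (X \<inter> Y) \<le> rk X + rk Y"
proof -
  obtain I where I: "I \<subseteq> X \<inter> Y" "indep I" "card I = rk (X \<inter> Y)" by (rule rk_witness)
  have "I \<subseteq> X \<union> Y" using I by blast
  from extend_indep[OF I(2) this] obtain J
    where J: "I \<subseteq> J" "J \<subseteq> X \<union> Y" "indep J" "card J = rk (X \<union> Y)" .
  have fin: "finite J" using J finite_if_indep by blast
  have "card J + card I \<le> card ((J \<inter> X) \<union> (J \<inter> Y)) + card ((J \<inter> X) \<inter> (J \<inter> Y))"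
    using I J fin by (intro add_mono card_mono) auto
  also have "\<dots> = card (J \<inter> X) + card (J \<inter> Y)"
    using fin by (intro card_Un_Int[symmetric]) auto
  also have "\<dots> \<le> rk X + rk Y"
    using J(3) by (intro add_mono card_le_rk) (auto intro: indep_subset)
  finally show ?thesis using I J by simp
qed

lemma rk_insert_le: "rk (insert e A) \<le> Suc (rk A)"
proof -
  obtain Y where Y: "Y \<subseteq> insert e A" "indep Y" "card Y = rk (insert e A)" by (rule rk_witness)
  have "card (Y - {e}) \<le> rk A"
    using Y by (intro card_le_rk) (auto intro: indep_subset)
  moreover have "card Y \<le> Suc (card (Y - {e}))"
    by (simp add: card_Diff_singleton_if) linarith
  ultimately show ?thesis using Y(3) by linarith
qed

lemma matroid_rank_eq: "matroid_rank E indep = rk E"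
  by (simp add: matroid_rank_def rk_def)

lemma basis_iff: "basis E indep B \<longleftrightarrow> indep B \<and> card B = rk E"
proof
  assume B: "basis E indep B"
  then have "indep B" "B \<subseteq> E" by (auto simp: basis_def)
  then obtain Y where "B \<subseteq> Y" "Y \<subseteq> E" "indep Y" "card Y = rk E"
    by (rule extend_indep)
  with B show "indep B \<and> card B = rk E" by (metis basis_def)
next
  assume B: "indep B \<and> card B = rk E"
  have "X = B" if "X \<subseteq> E" "indep X" "B \<subseteq> X" for X
    using that B card_le_rk[of X E] card_subset_eq[of X B] card_mono[of X B] finite_if_indep[of X]
    by simp
  then show "basis E indep B" using B indep_ground by (auto simp: basis_def)
qed

lemma basis_ground: "basis E indep B \<Longrightarrow> B \<subseteq> E" by (simp add: basis_def)

lemma basis_finite: "basis E indep B \<Longrightarrow> finite B"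
  using basis_ground finite_ground finite_subset by blast

lemma basis_in_full_rank:
  assumes "rk S = rk E"
  obtains B where "B \<subseteq> S" "basis E indep B"
  using rk_witness[of S] assms basis_iff by metis

text \<open>
  In terms of bases of \<open>M\<close>, the circuits of the dual matroid are therefore the minimal sets that
  meet every basis.
\<close>

lemma not_dual_indep_iff:
  "D \<subseteq> E \<Longrightarrow> \<not> dual_indep E indep D \<longleftrightarrow> (\<forall>B. basis E indep B \<longrightarrow> B \<inter> D \<noteq> {})"
  by (auto simp: dual_indep_def)

lemma minimal_dependent:
  assumes "S \<subseteq> E" "\<not> ind S"
  obtains D where "circuit E ind D" "D \<subseteq> S"
proof -
  have "finite S" using assms finite_ground finite_subset by blast
  then have "\<exists>D\<subseteq>S. \<not> ind D \<and> (\<forall>X. X \<subset> D \<longrightarrow> ind X)"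
    using assms(2)
  proof (induction S rule: finite_psubset_induct)
    case (psubset S)
    show ?case
    proof (cases "\<forall>X. X \<subset> S \<longrightarrow> ind X")
      case True
      then show ?thesis using psubset.prems by blast
    next
      case False
      then obtain X where X: "X \<subset> S" "\<not> ind X" by blast
      from psubset.IH[OF this] obtain D
        where "D \<subseteq> X" "\<not> ind D" "\<forall>X. X \<subset> D \<longrightarrow> ind X" by blast
      with X(1) show ?thesis by (intro exI[of _ D]) auto
    qed
  qed
  then obtain D where "D \<subseteq> S" "\<not> ind D" "\<forall>X. X \<subset> D \<longrightarrow> ind X" by blast
  with assms(1) have "circuit E ind D" by (auto simp: circuit_def)
  with \<open>D \<subseteq> S\<close> that show thesis by blast
qed

lemma finite_circuits: "finite {C. circuit E ind C}"
  using finite_ground by (auto simp: circuit_def intro: finite_subset[of _ "Pow E"])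

lemma card_circuit_le: "circuit E ind C \<Longrightarrow> card C \<le> circumference E ind"
  unfolding circumference_def using finite_circuits by (intro Max_ge) auto

text \<open>
  The set \<open>E - A\<close> meets all bases, so it contains a minimal set \<open>D\<close> with this
  property.  The complement of \<open>D\<close> is a hyperplane, which is why adding an
  element of \<open>D\<close> to \<open>A\<close> raises the rank: otherwise, by submodularity, it would not raise the
  rank of the hyperplane either.  In other words \<open>D\<close> is a cocircuit of the contraction
  \<open>M / A\<close>, and all its elements are nonloops there.
\<close>

lemma cocircuit_off:
  assumes A: "A \<subseteq> E" "rk A < rk E"
  obtains D where "circuit E (dual_indep E indep) D" "D \<subseteq> E - A"
    "\<forall>e\<in>D. rk (insert e A) = Suc (rk A)"
proof -
  have "B \<inter> (E - A) \<noteq> {}" if B: "basis E indep B" for B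
  proof
    assume "B \<inter> (E - A) = {}"
    then have "B \<subseteq> A" using basis_ground[OF B] by blast
    then show False using A(2) B basis_iff card_le_rk[of B A] by simp
  qed
  then have "\<not> dual_indep E indep (E - A)" by (subst not_dual_indep_iff) auto
  then obtain D where D: "circuit E (dual_indep E indep) D" "D \<subseteq> E - A"
    by (rule minimal_dependent[OF Diff_subset])
  have DE: "D \<subseteq> E" using D(2) by blast
  have "rk (insert e A) = Suc (rk A)" if e: "e \<in> D" for e
  proof (rule ccontr)
    assume "rk (insert e A) \<noteq> Suc (rk A)"
    with rk_insert_le[of e A] have le: "rk (insert e A) \<le> rk A" by simp
    have "dual_indep E indep (D - {e})" using D(1) e by (auto simp: circuit_def)
    then obtain B where B: "basis E indep B" "B \<inter> (D - {e}) = {}"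
      by (auto simp: dual_indep_def)
    obtain B' where B': "B' \<subseteq> E - D" "indep B'" "card B' = rk (E - D)" by (rule rk_witness)
    have "\<not> basis E indep B'"
      using D(1) B' DE not_dual_indep_iff[OF DE] by (auto simp: circuit_def)
    then have "rk (E - D) < rk E"
      using B' basis_iff rk_mono[of "E - D" E] by force
    moreover have "rk E \<le> rk (insert e (E - D))"
      using B basis_ground[OF B(1)] basis_iff card_le_rk[of B "insert e (E - D)"] by auto
    moreover have "rk (insert e (E - D)) + rk A \<le> rk (E - D) + rk (insert e A)"
    proof -
      have "rk ((E - D) \<union> insert e A) + rk ((E - D) \<inter> insert e A) \<le> rk (E - D) + rk (insert e A)"
        by (rule rk_submodular)
      moreover have "(E - D) \<union> insert e A = insert e (E - D)" "(E - D) \<inter> insert e A = A"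
        using D(2) A(1) e by auto
      ultimately show ?thesis by simp
    qed
    ultimately show False using le by linarith
  qed
  with D that show thesis by blast
qed

lemma cocircuit_nonempty:
  assumes D: "circuit E (dual_indep E indep) D"
  shows "D \<noteq> {}"
proof
  assume "D = {}"
  moreover obtain B where "basis E indep B" using basis_in_full_rank[of E] by blast
  ultimately show False using D by (auto simp: circuit_def dual_indep_def)
qed

text \<open>
  A cocircuit of \<open>M / A\<close> has at most \<open>c\<close> elements, so one of them, \<open>e\<close>, has
  weight at least \<open>s / c\<close>.  Contracting \<open>e\<close> lowers the rank by one and takes away that
  much weight, until rank one is reached, where a single cocircuit provides weight \<open>s\<close>.  In
  all this is \<open>n s / c + s\<close>, as \<open>M / A\<close> has rank \<open>n + 1\<close>.  Uniform matroids with constant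
  weight show that no better bound holds in general.
\<close>

lemma cocircuit_cover_bound:
  fixes a :: "'e \<Rightarrow> nat"
  assumes size: "\<And>D. circuit E (dual_indep E indep) D \<Longrightarrow> card D \<le> c"
    and cover: "\<And>D. circuit E (dual_indep E indep) D \<Longrightarrow> s \<le> sum a D"
    and "A \<subseteq> E" "rk E = rk A + Suc n"
  shows "s * (n + c) \<le> c * sum a (E - A)"
  using assms(3,4)
proof (induction n arbitrary: A)
  case 0
  then have "rk A < rk E" by simp
  with "0.prems"(1) obtain D where D: "circuit E (dual_indep E indep) D" "D \<subseteq> E - A"
    by (rule cocircuit_off)
  have "s \<le> sum a D" using cover D by blast
  also have "\<dots> \<le> sum a (E - A)" using D finite_ground by (intro sum_mono2) auto
  finally show ?case by (simp add: mult.commute)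
next
  case (Suc n)
  have "rk A < rk E" using Suc.prems by simp
  with Suc.prems(1) obtain D where D: "circuit E (dual_indep E indep) D" "D \<subseteq> E - A"
      "\<forall>e\<in>D. rk (insert e A) = Suc (rk A)"
    by (rule cocircuit_off)
  have fin: "finite D" using D(2) finite_ground finite_subset by blast
  have ne: "D \<noteq> {}" by (rule cocircuit_nonempty[OF D(1)])
  obtain e where e: "e \<in> D" "s \<le> c * a e"
  proof (rule ccontr)
    assume "\<not> thesis"
    with that have "\<And>e. e \<in> D \<Longrightarrow> c * a e < s" by (meson not_le)
    then have "(\<Sum>e\<in>D. c * a e) < (\<Sum>e\<in>D. s)" using fin ne by (intro sum_strict_mono) auto
    also have "\<dots> \<le> c * s" using size[OF D(1)] by simp
    also have "\<dots> \<le> c * sum a D" using cover[OF D(1)] by simp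
    finally show False by (simp add: sum_distrib_left)
  qed
  have eE: "e \<in> E - A" using e D by blast
  have "s * (Suc n + c) = s + s * (n + c)" by simp
  also have "\<dots> \<le> c * a e + c * sum a (E - insert e A)"
    using Suc.IH[of "insert e A"] D(3) Suc.prems e eE by (intro add_mono) auto
  also have "\<dots> = c * (a e + sum a (E - A - {e}))"
    by (simp only: Diff_insert[of E e A] distrib_left)
  also have "a e + sum a (E - A - {e}) = sum a (E - A)"
    using eE finite_ground by (intro sum.remove[symmetric]) auto
  finally show ?case .
qed

text \<open>
  Edmonds' theorem on packing bases, for elements with multiplicities \<open>a\<close>.  Each of the
  \<open>a e\<close> copies of \<open>e\<close> has to be assigned to one of the \<open>m\<close> colours such that every colour
  class \<open>S X i\<close> spans.  This asks for a transversal of the sets \<open>{e} \<times> {..<m}\<close>, one for each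
  copy, of rank \<open>m * rk E\<close> in the direct sum of \<open>m\<close> copies of the matroid.  As there are
  in general more copies than that, the surplus is added to the rank function as a constant.
\<close>

lemma base_packing:
  fixes a :: "'e \<Rightarrow> nat"
  assumes dense: "\<And>A. A \<subseteq> E \<Longrightarrow> m * rk E \<le> m * rk A + sum a (E - A)"
  obtains B where "\<forall>i<m. basis E indep (B i)" "\<forall>e. card {i. i < m \<and> e \<in> B i} \<le> a e"
proof (cases "m = 0")
  case True
  then show thesis using that by simp
next
  case False
  define J where "J = (SIGMA e:E. {..<a e})"
  define S where "S = (\<lambda>(X :: ('e \<times> nat) set) i. {e. (e, i) \<in> X})"
  define f where "f = (\<lambda>X. (\<Sum>i<m. rk (S X i)) + (sum a E - m * rk E))"
  have cov: "m * rk E \<le> sum a E"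
  proof -
    have "rk {} = 0" using rk_witness[of "{}"] by force
    then show ?thesis using dense[of "{}"] by simp
  qed
  have "\<exists>x. (\<forall>j\<in>J. x j \<in> {fst j} \<times> {..<m}) \<and> card J \<le> f (x ` J)"
  proof (rule submodular_transversal)
    show "finite J" using finite_ground by (auto simp: J_def)
    show "f X \<le> f Y" if "X \<subseteq> Y" for X Y
      using that unfolding f_def S_def by (intro add_mono sum_mono rk_mono) auto
    show "f (X \<union> Y) + f (X \<inter> Y) \<le> f X + f Y" for X Y
    proof -
      have "(\<Sum>i<m. rk (S (X \<union> Y) i) + rk (S (X \<inter> Y) i)) \<le> (\<Sum>i<m. rk (S X i) + rk (S Y i))"
      proof (rule sum_mono)
        fix i
        have "S (X \<union> Y) i = S X i \<union> S Y i" "S (X \<inter> Y) i = S X i \<inter> S Y i"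
          by (auto simp: S_def)
        then show "rk (S (X \<union> Y) i) + rk (S (X \<inter> Y) i) \<le> rk (S X i) + rk (S Y i)"
          using rk_submodular by simp
      qed
      then show ?thesis by (simp add: f_def sum.distrib)
    qed
    show "card K \<le> f (\<Union>j\<in>K. {fst j} \<times> {..<m})" if K: "K \<subseteq> J" for K
    proof -
      let ?F = "fst ` K"
      have F: "?F \<subseteq> E" using K by (auto simp: J_def)
      have finF: "finite ?F" using F finite_ground finite_subset by blast
      have "S (\<Union>j\<in>K. {fst j} \<times> {..<m}) i = ?F" if "i < m" for i
        using that by (auto simp: S_def)
      then have "f (\<Union>j\<in>K. {fst j} \<times> {..<m}) = m * rk ?F + (sum a E - m * rk E)"
        by (simp add: f_def)
      moreover have "card K \<le> sum a ?F"
      proof -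
        have "card K \<le> card (SIGMA e:?F. {..<a e})"
          using K finF by (intro card_mono) (force simp: J_def)+
        then show ?thesis using finF by simp
      qed
      moreover have "sum a E = sum a (E - ?F) + sum a ?F"
        using F finite_ground by (rule sum.subset_diff)
      ultimately show ?thesis using dense[OF F] cov by linarith
    qed
  qed (use False in auto)
  then obtain x where x': "\<forall>j\<in>J. x j \<in> {fst j} \<times> {..<m}" "card J \<le> f (x ` J)"
    by blast
  then have x: "\<And>j. j \<in> J \<Longrightarrow> fst (x j) = fst j" "card J \<le> f (x ` J)"
    by (auto simp: mem_Times_iff)
  have "card J = sum a E" using finite_ground by (simp add: J_def)
  with x(2) cov have total: "m * rk E \<le> (\<Sum>i<m. rk (S (x ` J) i))" by (simp add: f_def)
  have SE: "S (x ` J) i \<subseteq> E" for i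
  proof
    fix e assume "e \<in> S (x ` J) i"
    then obtain j where "j \<in> J" "x j = (e, i)" by (auto simp: S_def)
    with x(1)[of j] show "e \<in> E" by (auto simp: J_def)
  qed
  \<comment> \<open>The ranks of the \<open>m\<close> colour classes add up to the largest possible value.\<close>
  have full: "rk (S (x ` J) i) = rk E" if "i < m" for i
  proof (rule ccontr)
    assume "rk (S (x ` J) i) \<noteq> rk E"
    with rk_mono[OF SE, of i] have "rk (S (x ` J) i) < rk E" by simp
    then have "(\<Sum>i<m. rk (S (x ` J) i)) < (\<Sum>i<m. rk E)"
      using that rk_mono[OF SE] by (intro sum_strict_mono_ex1) auto
    with total show False by simp
  qed
  then have "\<forall>i. \<exists>B. i < m \<longrightarrow> B \<subseteq> S (x ` J) i \<and> basis E indep B"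
    using basis_in_full_rank by metis
  then obtain B where B: "\<And>i. i < m \<Longrightarrow> B i \<subseteq> S (x ` J) i" "\<And>i. i < m \<Longrightarrow> basis E indep (B i)"
    by metis
  have "card {i. i < m \<and> e \<in> B i} \<le> a e" for e
  proof -
    have "{i. i < m \<and> e \<in> B i} \<subseteq> (\<lambda>l. snd (x (e, l))) ` {..<a e}"
    proof clarify
      fix i assume "i < m" "e \<in> B i"
      with B(1) have "(e, i) \<in> x ` J" by (auto simp: S_def)
      then obtain j where j: "j \<in> J" "x j = (e, i)" by auto
      with x(1)[of j] show "i \<in> (\<lambda>l. snd (x (e, l))) ` {..<a e}"
        by (intro image_eqI[of _ _ "snd j"]) (auto simp: J_def)
    qed
    then have "card {i. i < m \<and> e \<in> B i} \<le> card {..<a e}" by (rule surj_card_le[rotated]) simp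
    then show ?thesis by simp
  qed
  with B(2) show thesis by (intro that[of B]) auto
qed

text \<open>
  Extending \<open>C\<close> minus one element to a basis gives \<open>A\<close>; it then works for all elements of
  \<open>C\<close>, because an augmentation within \<open>A \<union> C\<close> can never complete the circuit.  The set
  \<open>A\<close> is to be contracted: in \<open>M / A\<close> the set \<open>C\<close> is still a circuit, and it spans.
\<close>

lemma circuit_completion:
  assumes C: "circuit E indep C"
  obtains A where "A \<subseteq> E - C" "card A + card C = Suc (rk E)"
    "\<forall>e\<in>C. basis E indep (A \<union> (C - {e}))"
proof -
  have CE: "C \<subseteq> E" and dep: "\<not> indep C" and ind: "\<And>e. e \<in> C \<Longrightarrow> indep (C - {e})"
    using C by (auto simp: circuit_def)
  have finC: "finite C" using CE finite_ground finite_subset by blast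
  obtain z where z: "z \<in> C" using dep indep_empty by fastforce
  obtain B where B: "C - {z} \<subseteq> B" "B \<subseteq> E" "indep B" "card B = rk E"
    using extend_indep[OF ind[OF z], of E] CE by blast
  define A where "A = B - C"
  have zB: "z \<notin> B" using B dep indep_subset[OF B(3), of C] by blast
  have finA: "finite A" using finite_if_indep[OF B(3)] by (simp add: A_def)
  have "B = A \<union> (C - {z})" using B(1) zB by (auto simp: A_def)
  moreover have "A \<inter> (C - {z}) = {}" by (auto simp: A_def)
  ultimately have "card B = card A + card (C - {z})"
    using finA finC by (simp add: card_Un_disjoint)
  then have cA: "card A + card C = Suc (rk E)"
    using card.remove[OF finC z] B(4) by linarith
  have "basis E indep (A \<union> (C - {e}))" if e: "e \<in> C" for e
  proof -
    have sub: "C - {e} \<subseteq> A \<union> C" by blast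
    obtain X where X: "C - {e} \<subseteq> X" "X \<subseteq> A \<union> C" "indep X" "card X = rk (A \<union> C)"
      by (rule extend_indep[OF ind[OF e] sub])
    have "rk E \<le> rk (A \<union> C)"
      using card_le_rk[OF B(3), of "A \<union> C"] B by (auto simp: A_def)
    have "e \<notin> X" using X(1) dep indep_subset[OF X(3), of C] by blast
    then have XA: "X \<subseteq> A \<union> (C - {e})" using X(2) by blast
    have "card (A \<union> (C - {e})) \<le> card A + card (C - {e})" by (rule card_Un_le)
    also have "\<dots> = rk E" using card.remove[OF finC e] cA by linarith
    also have "\<dots> \<le> card X" using X \<open>rk E \<le> rk (A \<union> C)\<close> by simp
    finally have "X = A \<union> (C - {e})"
      using XA finA finC by (intro card_seteq) auto
    moreover have "card X = rk E"
      using X(4) \<open>rk E \<le> rk (A \<union> C)\<close> card_le_rk[OF X(3) indep_ground[OF X(3)]] by linarith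
    ultimately show ?thesis using X(3) basis_iff by blast
  qed
  moreover have "A \<subseteq> E - C" using B by (auto simp: A_def)
  ultimately show thesis using that cA by blast
qed

end

section \<open>Monomials and the ideals that contain them\<close>

abbreviation monom :: "('e \<Rightarrow>\<^sub>0 nat) \<Rightarrow> ('e, 'k::field) mpoly" where
  "monom m \<equiv> Poly_Mapping.single m 1"

definition deg_on :: "'e set \<Rightarrow> ('e \<Rightarrow>\<^sub>0 nat) \<Rightarrow> nat" where
  "deg_on C m = (\<Sum>e\<in>C. Poly_Mapping.lookup m e)"

text \<open>
  This is the \<open>d\<close>-th power of the prime ideal generated by the variables in \<open>C\<close>, described by
  its monomials (for finite \<open>C \<subseteq> E\<close>).
\<close>

definition order_ideal :: "'e set \<Rightarrow> 'e set \<Rightarrow> nat \<Rightarrow> ('e, 'k::field) mpoly set" where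
  "order_ideal E C d =
     {p \<in> carrier (poly_ring E). \<forall>m\<in>Poly_Mapping.keys p. d \<le> deg_on C m}"

definition exponent :: "'e set \<Rightarrow> ('e \<Rightarrow> nat) \<Rightarrow> ('e \<Rightarrow>\<^sub>0 nat)" where
  "exponent B a = (\<Sum>e\<in>B. Poly_Mapping.single e (a e))"

lemma poly_ring_sel [simp]:
  "p \<otimes>\<^bsub>poly_ring E\<^esub> q = p * q" "p \<oplus>\<^bsub>poly_ring E\<^esub> q = p + q"
  "\<one>\<^bsub>poly_ring E\<^esub> = 1" "\<zero>\<^bsub>poly_ring E\<^esub> = 0"
  by (simp_all add: poly_ring_def)

lemma poly_ring_carrier_iff:
  "p \<in> carrier (poly_ring E) \<longleftrightarrow> (\<forall>m\<in>Poly_Mapping.keys p. Poly_Mapping.keys m \<subseteq> E)"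
  by (simp add: poly_ring_def)

lemma poly_ring_ring: "ring (poly_ring E :: ('e, 'k::field) mpoly ring)"
  using poly_ring_cring cring.axioms(1) by blast

lemma deg_on_add: "deg_on C (m + n) = deg_on C m + deg_on C n"
  by (simp add: deg_on_def lookup_add sum.distrib)

lemma lookup_exponent:
  assumes "finite B"
  shows "Poly_Mapping.lookup (exponent B a) e = (if e \<in> B then a e else 0)"
proof -
  have "Poly_Mapping.lookup (exponent B a) e = (\<Sum>b\<in>B. if b = e then a b else 0)"
    unfolding exponent_def lookup_sum by (intro sum.cong) (auto simp: lookup_single when_def)
  then show ?thesis using assms by (simp add: sum.delta)
qed

lemma keys_exponent: "finite B \<Longrightarrow> Poly_Mapping.keys (exponent B a) \<subseteq> B"
  by (auto simp: lookup_exponent in_keys_iff split: if_splits)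

lemma monom_carrier: "Poly_Mapping.keys m \<subseteq> E \<Longrightarrow> monom m \<in> carrier (poly_ring E)"
  by (simp add: poly_ring_carrier_iff)

lemma monom_add: "(monom (m + n) :: ('e, 'k::field) mpoly) = monom m * monom n"
  by (simp add: mult_single)

lemma monom_sum:
  "finite I \<Longrightarrow> (monom (\<Sum>i\<in>I. f i) :: ('e, 'k::field) mpoly) = (\<Prod>i\<in>I. monom (f i))"
  by (induction I rule: finite_induct) (simp_all add: monom_add)

lemma prod_vars_eq_monom:
  "finite B \<Longrightarrow> (\<Prod>e\<in>B. poly_var e :: ('e, 'k::field) mpoly) = monom (exponent B (\<lambda>_. 1))"
  by (simp add: exponent_def monom_sum poly_var_def)

lemma poly_sum_monom:
  "p = (\<Sum>m\<in>Poly_Mapping.keys p. Poly_Mapping.single m (Poly_Mapping.lookup p m))"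
proof (rule poly_mapping_eqI)
  fix k
  have "Poly_Mapping.lookup (\<Sum>m\<in>Poly_Mapping.keys p. Poly_Mapping.single m (Poly_Mapping.lookup p m)) k
      = (\<Sum>m\<in>Poly_Mapping.keys p. if m = k then Poly_Mapping.lookup p m else 0)"
    unfolding lookup_sum by (intro sum.cong) (auto simp: lookup_single when_def)
  also have "\<dots> = Poly_Mapping.lookup p k"
    by (simp add: sum.delta in_keys_iff)
  finally show "Poly_Mapping.lookup p k = Poly_Mapping.lookup
      (\<Sum>m\<in>Poly_Mapping.keys p. Poly_Mapping.single m (Poly_Mapping.lookup p m)) k" ..
qed

lemma ideal_memI_monoms:
  fixes I :: "('e, 'k::field) mpoly set"
  assumes I: "ideal I (poly_ring E)"
    and "\<And>m. m \<in> Poly_Mapping.keys p \<Longrightarrow> monom m \<in> I"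
  shows "p \<in> I"
proof -
  interpret ideal I "poly_ring E" by (rule I)
  have "(\<Sum>m\<in>K. Poly_Mapping.single m (Poly_Mapping.lookup p m)) \<in> I"
    if "finite K" "K \<subseteq> Poly_Mapping.keys p" for K
    using that
  proof (induction K rule: finite_induct)
    case empty
    then show ?case using additive_subgroup.zero_closed[OF is_additive_subgroup] by simp
  next
    case (insert m K)
    have "Poly_Mapping.single 0 (Poly_Mapping.lookup p m) \<otimes>\<^bsub>poly_ring E\<^esub> monom m \<in> I"
      using insert.prems by (intro I_l_closed assms(2)) (auto simp: poly_ring_carrier_iff)
    then have "Poly_Mapping.single m (Poly_Mapping.lookup p m) \<in> I"
      by (simp add: mult_single)
    moreover have "(\<Sum>m\<in>K. Poly_Mapping.single m (Poly_Mapping.lookup p m)) \<in> I"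
      using insert.IH insert.prems by blast
    ultimately have "Poly_Mapping.single m (Poly_Mapping.lookup p m) \<oplus>\<^bsub>poly_ring E\<^esub>
        (\<Sum>m\<in>K. Poly_Mapping.single m (Poly_Mapping.lookup p m)) \<in> I"
      by (rule additive_subgroup.a_closed[OF is_additive_subgroup])
    then show ?case using insert.hyps by simp
  qed
  from this[OF finite_keys order_refl] show ?thesis using poly_sum_monom[of p] by simp
qed

lemma ideal_monom_dvd:
  fixes I :: "('e, 'k::field) mpoly set"
  assumes I: "ideal I (poly_ring E)" and m: "monom m \<in> I"
    and le: "\<And>e. Poly_Mapping.lookup m e \<le> Poly_Mapping.lookup n e"
    and n: "Poly_Mapping.keys n \<subseteq> E"
  shows "monom n \<in> I"
proof -
  interpret ideal I "poly_ring E" by (rule I)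
  have eq: "n = (n - m) + m"
    by (rule poly_mapping_eqI) (simp add: lookup_add lookup_minus le)
  have "Poly_Mapping.keys (n - m) \<subseteq> E"
    using n by (auto simp: in_keys_iff lookup_minus)
  then have "monom (n - m) \<otimes>\<^bsub>poly_ring E\<^esub> monom m \<in> I"
    by (intro I_l_closed m monom_carrier)
  then show ?thesis using eq by (metis monom_add poly_ring_sel(1))
qed

lemma deg_on_exponent:
  "finite B \<Longrightarrow> finite C \<Longrightarrow> deg_on C (exponent B a) = sum a (B \<inter> C)"
  by (simp add: deg_on_def lookup_exponent sum.inter_restrict[symmetric] Int_commute)

lemma lookup_le_deg_on: "finite V \<Longrightarrow> e \<in> V \<Longrightarrow> Poly_Mapping.lookup m e \<le> deg_on V m"
  unfolding deg_on_def by (intro member_le_sum) auto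

section \<open>Powers of ideals and degrees of monomials\<close>

lemma ideal_order_ideal: "ideal (order_ideal E C d) (poly_ring E :: ('e, 'k::field) mpoly ring)"
proof -
  let ?R = "poly_ring E :: ('e, 'k) mpoly ring"
  interpret cring ?R by (rule poly_ring_cring)
  have mult: "x * y \<in> order_ideal E C d"
    if x: "x \<in> order_ideal E C d" and y: "y \<in> carrier ?R" for x y
  proof -
    have "x * y \<in> carrier ?R" using x y m_closed[of x y] by (simp add: order_ideal_def)
    moreover have "d \<le> deg_on C m" if "m \<in> Poly_Mapping.keys (x * y)" for m
    proof -
      obtain a b where "m = a + b" "a \<in> Poly_Mapping.keys x"
        using \<open>m \<in> _\<close> Poly_Mapping.keys_mult[of x y] by blast
      then show ?thesis using x by (auto simp: order_ideal_def deg_on_add intro: trans_le_add1)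
    qed
    ultimately show ?thesis by (simp add: order_ideal_def)
  qed
  show ?thesis
  proof (rule idealI)
    show "ring ?R" by (rule ring_axioms)
    show "subgroup (order_ideal E C d) (add_monoid ?R)"
    proof (rule subgroup.intro)
      fix x :: "('e, 'k) mpoly" assume x: "x \<in> order_ideal E C d"
      have "- x \<in> order_ideal E C d" using x by (simp add: order_ideal_def poly_ring_carrier_iff)
      moreover have "\<ominus>\<^bsub>?R\<^esub> x = - x"
        using x calculation by (intro minus_equality) (auto simp: order_ideal_def)
      ultimately show "inv\<^bsub>add_monoid ?R\<^esub> x \<in> order_ideal E C d" by (simp add: a_inv_def)
    next
      fix x y :: "('e, 'k) mpoly"
      assume "x \<in> order_ideal E C d" "y \<in> order_ideal E C d"
      then show "x \<otimes>\<^bsub>add_monoid ?R\<^esub> y \<in> order_ideal E C d"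
        using Poly_Mapping.keys_add[of x y] a_closed[of x y] by (auto simp: order_ideal_def)
    qed (auto simp: order_ideal_def poly_ring_carrier_iff)
    show "x \<otimes>\<^bsub>?R\<^esub> a \<in> order_ideal E C d" "a \<otimes>\<^bsub>?R\<^esub> x \<in> order_ideal E C d"
      if "a \<in> order_ideal E C d" "x \<in> carrier ?R" for a x
      using mult[OF that] by (simp_all add: mult.commute)
  qed
qed

lemma order_ideal_mult:
  assumes p: "p \<in> order_ideal E C d" and q: "q \<in> order_ideal E C d'"
  shows "p * q \<in> order_ideal E C (d + d')"
proof -
  interpret cring "poly_ring E :: ('a, 'b) mpoly ring" by (rule poly_ring_cring)
  have "p * q \<in> carrier (poly_ring E)"
    using p q m_closed[of p q] by (simp add: order_ideal_def)
  moreover have "d + d' \<le> deg_on C m" if m: "m \<in> Poly_Mapping.keys (p * q)" for m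
  proof -
    obtain a b where "m = a + b" "a \<in> Poly_Mapping.keys p" "b \<in> Poly_Mapping.keys q"
      using m Poly_Mapping.keys_mult[of p q] by blast
    then show ?thesis using p q by (auto simp: order_ideal_def deg_on_add intro: add_mono)
  qed
  ultimately show ?thesis by (simp add: order_ideal_def)
qed

lemma ideals_set_sel [simp]:
  "\<one>\<^bsub>ideals_set R\<^esub> = carrier R" "I \<otimes>\<^bsub>ideals_set R\<^esub> J = I \<cdot>\<^bsub>R\<^esub> J"
  by (simp_all add: ideals_set_def)

lemma (in cring) ideal_pow_ideal: "ideal I R \<Longrightarrow> ideal (I [^]\<^bsub>ideals_set R\<^esub> (n::nat)) R"
  by (induction n) (simp_all add: oneideal ideal_prod_is_ideal)

lemma (in cring) ideal_pow_mult_mem: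
  "x \<in> I [^]\<^bsub>ideals_set R\<^esub> (n::nat) \<Longrightarrow> y \<in> I \<Longrightarrow> x \<otimes> y \<in> I [^]\<^bsub>ideals_set R\<^esub> Suc n"
  by (simp add: ideal_prod.prod)

lemma pow_subset_order_ideal:
  fixes I :: "('e, 'k::field) mpoly set"
  assumes I: "I \<subseteq> order_ideal E C d"
  shows "I [^]\<^bsub>ideals_set (poly_ring E)\<^esub> (n::nat) \<subseteq> order_ideal E C (n * d)"
proof -
  interpret cring "poly_ring E :: ('e, 'k) mpoly ring" by (rule poly_ring_cring)
  show ?thesis
  proof (induction n)
    case 0
    then show ?case by (auto simp: order_ideal_def)
  next
    case (Suc n)
    show ?case
    proof
      fix p assume "p \<in> I [^]\<^bsub>ideals_set (poly_ring E)\<^esub> Suc n"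
      then have "p \<in> (I [^]\<^bsub>ideals_set (poly_ring E)\<^esub> n) \<cdot>\<^bsub>poly_ring E\<^esub> I" by simp
      then show "p \<in> order_ideal E C (Suc n * d)"
      proof (induction rule: ideal_prod.induct)
        case (prod x y)
        then have "x * y \<in> order_ideal E C (n * d + d)" using Suc I by (blast intro: order_ideal_mult)
        then show ?case by (simp add: add.commute)
      next
        case (sum x y)
        then show ?case
          using additive_subgroup.a_closed[OF ideal.axioms(1)[OF ideal_order_ideal]] by blast
      qed
    qed
  qed
qed

lemma monom_prod_pow:
  fixes I :: "('e, 'k::field) mpoly set"
  assumes "\<And>i. i < n \<Longrightarrow> monom (f i) \<in> I"
  shows "monom (\<Sum>i<n. f i) \<in> I [^]\<^bsub>ideals_set (poly_ring E)\<^esub> (n::nat)"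
proof -
  interpret cring "poly_ring E :: ('e, 'k) mpoly ring" by (rule poly_ring_cring)
  show ?thesis using assms
  proof (induction n)
    case 0
    then show ?case using one_closed by simp
  next
    case (Suc n)
    then have "monom (\<Sum>i<n. f i) \<otimes>\<^bsub>poly_ring E\<^esub> monom (f n) \<in> I [^]\<^bsub>ideals_set (poly_ring E)\<^esub> Suc n"
      by (intro ideal_pow_mult_mem) auto
    then show ?case by (simp add: mult_single)
  qed
qed

lemma monom_pow_of_vars:
  fixes P :: "('e, 'k::field) mpoly set"
  assumes V: "finite V" "\<And>e. e \<in> V \<Longrightarrow> poly_var e \<in> P"
    and m: "Poly_Mapping.keys m \<subseteq> E" "s \<le> deg_on V m"
  shows "monom m \<in> P [^]\<^bsub>ideals_set (poly_ring E)\<^esub> s"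
  using m
proof (induction s arbitrary: m)
  case 0
  interpret cring "poly_ring E :: ('e, 'k) mpoly ring" by (rule poly_ring_cring)
  show ?case using 0 by (simp add: monom_carrier)
next
  case (Suc s)
  interpret cring "poly_ring E :: ('e, 'k) mpoly ring" by (rule poly_ring_cring)
  from Suc.prems(2) have "deg_on V m \<noteq> 0" by simp
  then obtain e where e: "e \<in> V" "Poly_Mapping.lookup m e \<noteq> 0"
    unfolding deg_on_def by (meson sum.not_neutral_contains_not_neutral)
  let ?n = "m - Poly_Mapping.single e 1"
  have eq: "m = ?n + Poly_Mapping.single e 1"
    using e(2) by (intro poly_mapping_eqI) (auto simp: lookup_add lookup_minus lookup_single when_def)
  have "deg_on V (Poly_Mapping.single e 1) = 1"
    using e(1) V(1) by (simp add: deg_on_def lookup_single when_def)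
  then have "deg_on V m = deg_on V ?n + 1" using eq deg_on_add by metis
  with Suc.prems(2) have "s \<le> deg_on V ?n" by simp
  moreover have "Poly_Mapping.keys ?n \<subseteq> E"
    using Suc.prems(1) by (auto simp: in_keys_iff lookup_minus)
  ultimately have "monom ?n \<otimes>\<^bsub>poly_ring E\<^esub> poly_var e \<in> P [^]\<^bsub>ideals_set (poly_ring E)\<^esub> Suc s"
    by (intro ideal_pow_mult_mem Suc.IH V(2) e(1))
  then show ?case using eq by (metis monom_add poly_ring_sel(1) poly_var_def)
qed

section \<open>Primes generated by variables\<close>

text \<open>
  A substitute for multiplying leading terms that requires no order on the variables: choose
  the variables one after another and keep only those exponents for which the current variable
  has maximal degree.  A sum of two survivors can only be decomposed into survivors.
\<close>

lemma exists_uniquely_attained_sum: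
  fixes K L :: "('e \<Rightarrow>\<^sub>0 nat) set"
  assumes "finite E" "finite K" "finite L" "K \<noteq> {}" "L \<noteq> {}"
    and supp: "\<And>m. m \<in> K \<union> L \<Longrightarrow> Poly_Mapping.keys m \<subseteq> E"
  obtains m n where "m \<in> K" "n \<in> L"
    "\<forall>m'\<in>K. \<forall>n'\<in>L. m' + n' = m + n \<longrightarrow> m' = m \<and> n' = n"
proof -
  have "\<exists>K' L'. K' \<subseteq> K \<and> L' \<subseteq> L \<and> K' \<noteq> {} \<and> L' \<noteq> {}
      \<and> (\<forall>m\<in>K'. \<forall>m'\<in>K'. \<forall>e\<in>F. Poly_Mapping.lookup m e = Poly_Mapping.lookup m' e)
      \<and> (\<forall>m\<in>L'. \<forall>m'\<in>L'. \<forall>e\<in>F. Poly_Mapping.lookup m e = Poly_Mapping.lookup m' e)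
      \<and> (\<forall>m\<in>K'. \<forall>n\<in>L'. \<forall>m'\<in>K. \<forall>n'\<in>L. m' + n' = m + n \<longrightarrow> m' \<in> K' \<and> n' \<in> L')"
    if "finite F" for F
    using that
  proof (induction F rule: finite_induct)
    case empty
    then show ?case using assms(4,5) by (intro exI[of _ K] exI[of _ L]) auto
  next
    case (insert e F)
    then obtain K' L' where KL: "K' \<subseteq> K" "L' \<subseteq> L" "K' \<noteq> {}" "L' \<noteq> {}"
      and agree: "\<forall>m\<in>K'. \<forall>m'\<in>K'. \<forall>e\<in>F. Poly_Mapping.lookup m e = Poly_Mapping.lookup m' e"
        "\<forall>m\<in>L'. \<forall>m'\<in>L'. \<forall>e\<in>F. Poly_Mapping.lookup m e = Poly_Mapping.lookup m' e"
      and split: "\<forall>m\<in>K'. \<forall>n\<in>L'. \<forall>m'\<in>K. \<forall>n'\<in>L. m' + n' = m + n \<longrightarrow> m' \<in> K' \<and> n' \<in> L'"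
      by blast
    let ?v = "\<lambda>m. Poly_Mapping.lookup m e"
    define a b where "a = Max (?v ` K')" and "b = Max (?v ` L')"
    have fin: "finite K'" "finite L'" using KL assms finite_subset by blast+
    have le: "\<And>m. m \<in> K' \<Longrightarrow> ?v m \<le> a" "\<And>n. n \<in> L' \<Longrightarrow> ?v n \<le> b"
      using fin by (auto simp: a_def b_def)
    have att: "a \<in> ?v ` K'" "b \<in> ?v ` L'"
      using fin KL by (auto simp: a_def b_def intro!: Max_in)
    let ?K = "{m \<in> K'. ?v m = a}" and ?L = "{n \<in> L'. ?v n = b}"
    have "m' \<in> ?K \<and> n' \<in> ?L"
      if "m \<in> ?K" "n \<in> ?L" "m' \<in> K" "n' \<in> L" "m' + n' = m + n" for m n m' n'
    proof -
      have mem: "m' \<in> K'" "n' \<in> L'" using that split by auto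
      have "?v m' + ?v n' = a + b" using that by (metis (mono_tags, lifting) lookup_add mem_Collect_eq)
      with le(1)[OF mem(1)] le(2)[OF mem(2)] mem show ?thesis by simp
    qed
    then have "\<forall>m\<in>?K. \<forall>n\<in>?L. \<forall>m'\<in>K. \<forall>n'\<in>L. m' + n' = m + n \<longrightarrow> m' \<in> ?K \<and> n' \<in> ?L"
      by blast
    moreover have "?K \<subseteq> K" "?L \<subseteq> L" "?K \<noteq> {}" "?L \<noteq> {}"
      using att KL(1,2) by auto
    moreover have "\<forall>m\<in>?K. \<forall>m'\<in>?K. \<forall>e\<in>insert e F. Poly_Mapping.lookup m e = Poly_Mapping.lookup m' e"
      "\<forall>m\<in>?L. \<forall>m'\<in>?L. \<forall>e\<in>insert e F. Poly_Mapping.lookup m e = Poly_Mapping.lookup m' e"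
      using agree by simp_all
    ultimately show ?case by (intro exI[of _ ?K] exI[of _ ?L] conjI)
  qed
  from this[OF assms(1)] obtain K' L' where KL: "K' \<subseteq> K" "L' \<subseteq> L" "K' \<noteq> {}" "L' \<noteq> {}"
    and agree: "\<forall>m\<in>K'. \<forall>m'\<in>K'. \<forall>e\<in>E. Poly_Mapping.lookup m e = Poly_Mapping.lookup m' e"
      "\<forall>m\<in>L'. \<forall>m'\<in>L'. \<forall>e\<in>E. Poly_Mapping.lookup m e = Poly_Mapping.lookup m' e"
    and split: "\<forall>m\<in>K'. \<forall>n\<in>L'. \<forall>m'\<in>K. \<forall>n'\<in>L. m' + n' = m + n \<longrightarrow> m' \<in> K' \<and> n' \<in> L'"
    by blast
  have eqI: "m = m'" if "m \<in> K \<union> L" "m' \<in> K \<union> L"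
      "\<forall>e\<in>E. Poly_Mapping.lookup m e = Poly_Mapping.lookup m' e" for m m'
  proof (rule poly_mapping_eqI)
    fix e
    show "Poly_Mapping.lookup m e = Poly_Mapping.lookup m' e"
      using that supp[of m] supp[of m'] by (metis in_keys_iff subsetD)
  qed
  from KL obtain m n where mn: "m \<in> K'" "n \<in> L'" by blast
  have "m' = m \<and> n' = n" if "m' \<in> K" "n' \<in> L" "m' + n' = m + n" for m' n'
  proof -
    have mem: "m' \<in> K'" "n' \<in> L'" using split mn that by blast+
    have "\<forall>e\<in>E. Poly_Mapping.lookup m' e = Poly_Mapping.lookup m e"
      "\<forall>e\<in>E. Poly_Mapping.lookup n' e = Poly_Mapping.lookup n e"
      using agree mem mn by blast+
    then show ?thesis using mem mn KL(1,2) by (intro conjI eqI) auto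
  qed
  with mn KL(1,2) that show thesis by blast
qed

lemma lookup_mult_unique:
  assumes "\<And>a b. a \<in> Poly_Mapping.keys p \<Longrightarrow> b \<in> Poly_Mapping.keys q \<Longrightarrow> a + b = m + n \<Longrightarrow> a = m \<and> b = n"
  shows "Poly_Mapping.lookup (p * q :: ('e, 'k::field) mpoly) (m + n) =
    Poly_Mapping.lookup p m * Poly_Mapping.lookup q n"
proof -
  have "Poly_Mapping.lookup p a * Sum_any (\<lambda>b. Poly_Mapping.lookup q b when m + n = a + b) =
      (Poly_Mapping.lookup p m * Poly_Mapping.lookup q n when a = m)" for a
  proof (cases "a \<in> Poly_Mapping.keys p")
    case False
    then show ?thesis by (auto simp: in_keys_iff when_def)
  next
    case True
    have "Sum_any (\<lambda>b. Poly_Mapping.lookup q b when m + n = a + b) =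
        Sum_any (\<lambda>b. (Poly_Mapping.lookup q n when a = m) when b = n)"
    proof (rule Sum_any.cong)
      fix b
      show "(Poly_Mapping.lookup q b when m + n = a + b) =
          ((Poly_Mapping.lookup q n when a = m) when b = n)"
      proof (cases "b \<in> Poly_Mapping.keys q")
        case bq: True
        show ?thesis using assms[OF True bq] by (auto simp: when_def)
      next
        case False
        then show ?thesis by (auto simp: in_keys_iff when_def)
      qed
    qed
    then show ?thesis by (simp add: when_def)
  qed
  then show ?thesis by (simp add: lookup_mult)
qed

text \<open>
  If neither \<open>p\<close> nor \<open>q\<close> lies in the ideal, both have monomials free of the variables in \<open>C\<close>.
  Among these there are two whose product is not obtained in any other way, and so it survives
  in \<open>p * q\<close>.
\<close>

lemma prime_order_ideal:
  fixes E C :: "'e set"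
  assumes E: "finite E" and C: "C \<subseteq> E"
  shows "primeideal (order_ideal E C 1) (poly_ring E :: ('e, 'k::field) mpoly ring)"
proof (rule primeidealI)
  show "ideal (order_ideal E C 1) (poly_ring E)" by (rule ideal_order_ideal)
  show "cring (poly_ring E)" by (rule poly_ring_cring)
  have "1 \<notin> (order_ideal E C 1 :: ('e, 'k) mpoly set)" by (simp add: order_ideal_def deg_on_def)
  moreover have "(1 :: ('e, 'k) mpoly) \<in> carrier (poly_ring E)" by (simp add: poly_ring_carrier_iff)
  ultimately show "carrier (poly_ring E) \<noteq> (order_ideal E C 1 :: ('e, 'k) mpoly set)" by metis
  fix p q :: "('e, 'k) mpoly"
  assume p: "p \<in> carrier (poly_ring E)" and q: "q \<in> carrier (poly_ring E)"
    and pq: "p \<otimes>\<^bsub>poly_ring E\<^esub> q \<in> order_ideal E C 1"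
  show "p \<in> order_ideal E C 1 \<or> q \<in> order_ideal E C 1"
  proof (rule ccontr)
    assume neither: "\<not> ?thesis"
    let ?K = "{m \<in> Poly_Mapping.keys p. deg_on C m = 0}"
    let ?L = "{m \<in> Poly_Mapping.keys q. deg_on C m = 0}"
    have ne: "?K \<noteq> {}" "?L \<noteq> {}"
      using neither p q by (force simp: order_ideal_def)+
    have supp: "\<And>m. m \<in> ?K \<union> ?L \<Longrightarrow> Poly_Mapping.keys m \<subseteq> E"
      using p q by (auto simp: poly_ring_carrier_iff)
    obtain m n where mn: "m \<in> ?K" "n \<in> ?L"
      "\<forall>m'\<in>?K. \<forall>n'\<in>?L. m' + n' = m + n \<longrightarrow> m' = m \<and> n' = n"
      by (rule exists_uniquely_attained_sum[OF E _ _ ne supp]) simp_all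
    have deg0: "deg_on C (m + n) = 0" using mn by (simp add: deg_on_add)
    have "Poly_Mapping.lookup (p * q) (m + n) = Poly_Mapping.lookup p m * Poly_Mapping.lookup q n"
    proof (rule lookup_mult_unique)
      fix a b assume ab: "a \<in> Poly_Mapping.keys p" "b \<in> Poly_Mapping.keys q" "a + b = m + n"
      then have "deg_on C a + deg_on C b = 0" using deg0 by (metis deg_on_add)
      then have "a \<in> ?K" "b \<in> ?L" using ab by simp_all
      with ab(3) mn(3) show "a = m \<and> b = n" by blast
    qed
    also have "\<dots> \<noteq> 0" using mn by (simp add: in_keys_iff)
    finally have "m + n \<in> Poly_Mapping.keys (p * q)" by (simp add: in_keys_iff)
    with pq deg0 show False by (auto simp: order_ideal_def)
  qed
qed

lemma prime_contains_var:
  fixes P :: "('e, 'k::field) mpoly set"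
  assumes P: "primeideal P (poly_ring E)" and "finite B" "B \<subseteq> E" "(\<Prod>e\<in>B. poly_var e) \<in> P"
  obtains e where "e \<in> B" "poly_var e \<in> P"
proof -
  interpret primeideal P "poly_ring E" by (rule P)
  have "\<exists>e\<in>B. poly_var e \<in> P"
    using assms(2-4)
  proof (induction B rule: finite_induct)
    case empty
    then have "\<one>\<^bsub>poly_ring E\<^esub> \<in> P" by simp
    then show ?case using one_imp_carrier I_notcarr by simp
  next
    case (insert e B)
    have "poly_var e \<in> carrier (poly_ring E)"
      using insert.prems by (simp add: poly_var_def monom_carrier)
    moreover have "(\<Prod>e\<in>B. poly_var e) \<in> carrier (poly_ring E)"
      using insert.hyps(1) insert.prems(1) keys_exponent[OF insert.hyps(1)]
      by (subst prod_vars_eq_monom) (auto intro!: monom_carrier)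
    moreover have "poly_var e \<otimes>\<^bsub>poly_ring E\<^esub> (\<Prod>e\<in>B. poly_var e) \<in> P"
      using insert by simp
    ultimately have "poly_var e \<in> P \<or> (\<Prod>e\<in>B. poly_var e) \<in> P" by (intro I_prime)
    then show ?case using insert by auto
  qed
  then show thesis using that by blast
qed

section \<open>Powers and symbolic powers of the facet ideal\<close>

context matroid
begin

lemma facet_ideal_eq:
  "(facet_ideal E indep :: ('e, 'k::field) mpoly set) =
    Idl\<^bsub>poly_ring E\<^esub> {monom (exponent B (\<lambda>_. 1)) | B. basis E indep B}"
proof -
  have "{\<Prod>e\<in>B. poly_var e | B. basis E indep B} =
      {monom (exponent B (\<lambda>_. 1)) :: ('e, 'k) mpoly | B. basis E indep B}"
    using prod_vars_eq_monom[OF basis_finite] by (intro Collect_cong ex_cong1) auto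
  then show ?thesis by (simp only: facet_ideal_def)
qed

lemma basis_monom_carrier:
  "basis E indep B \<Longrightarrow> monom (exponent B a) \<in> carrier (poly_ring E)"
  using keys_exponent[OF basis_finite] basis_ground by (blast intro: monom_carrier)

lemma ideal_facet_ideal: "ideal (facet_ideal E indep :: ('e, 'k::field) mpoly set) (poly_ring E)"
  unfolding facet_ideal_eq using basis_monom_carrier
  by (intro ring.genideal_ideal[OF poly_ring_ring]) auto

lemma basis_monom_facet_ideal:
  "basis E indep B \<Longrightarrow> (monom (exponent B (\<lambda>_. 1)) :: ('e, 'k::field) mpoly) \<in> facet_ideal E indep"
  unfolding facet_ideal_eq
  using ring.genideal_self[OF poly_ring_ring, of "{monom (exponent B (\<lambda>_. 1)) | B. basis E indep B}" E]
    basis_monom_carrier by blast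

lemma facet_ideal_subsetI:
  assumes "ideal J (poly_ring E :: ('e, 'k::field) mpoly ring)"
    and "\<And>B. basis E indep B \<Longrightarrow> monom (exponent B (\<lambda>_. 1)) \<in> J"
  shows "facet_ideal E indep \<subseteq> J"
  unfolding facet_ideal_eq using assms(2)
  by (intro ring.genideal_minimal[OF poly_ring_ring assms(1)]) auto

lemma facet_ideal_subset_order_ideal:
  assumes "C \<subseteq> E" "\<And>B. basis E indep B \<Longrightarrow> d \<le> card (B \<inter> C)"
  shows "(facet_ideal E indep :: ('e, 'k::field) mpoly set) \<subseteq> order_ideal E C d"
proof (rule facet_ideal_subsetI[OF ideal_order_ideal])
  fix B assume B: "basis E indep B"
  have "finite C" using assms(1) finite_ground finite_subset by blast
  then show "(monom (exponent B (\<lambda>_. 1)) :: ('e, 'k) mpoly) \<in> order_ideal E C d"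
    using assms(2)[OF B] basis_monom_carrier[OF B] basis_finite[OF B]
    by (simp add: order_ideal_def deg_on_exponent)
qed

lemma prime_vars_meet_basis:
  fixes P :: "('e, 'k::field) mpoly set"
  assumes P: "primeideal P (poly_ring E)" "facet_ideal E indep \<subseteq> P" and B: "basis E indep B"
  shows "B \<inter> {e \<in> E. poly_var e \<in> P} \<noteq> {}"
proof -
  have "(\<Prod>e\<in>B. poly_var e) \<in> P"
    using basis_monom_facet_ideal[OF B] P(2) prod_vars_eq_monom[OF basis_finite[OF B]]
    by (metis subsetD)
  then obtain e where "e \<in> B" "poly_var e \<in> P"
    by (rule prime_contains_var[OF P(1) basis_finite[OF B] basis_ground[OF B]])
  then show ?thesis using basis_ground[OF B] by blast
qed

text \<open>
  A prime ideal that contains the facet ideal contains, for every basis, one of its variables.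
  Below the ideal generated by the variables of a cocircuit these variables must be all
  of the cocircuit, since no proper subset meets every basis.
\<close>

lemma cocircuit_minimal_prime:
  assumes D: "circuit E (dual_indep E indep) D"
  shows "order_ideal E D 1 \<in>
    minimal_primes (poly_ring E) (facet_ideal E indep :: ('e, 'k::field) mpoly set)"
proof -
  have DE: "D \<subseteq> E" and dep: "\<not> dual_indep E indep D"
    and ind: "\<And>X. X \<subset> D \<Longrightarrow> dual_indep E indep X"
    using D by (auto simp: circuit_def)
  have finD: "finite D" using DE finite_ground finite_subset by blast
  have sub: "(facet_ideal E indep :: ('e, 'k) mpoly set) \<subseteq> order_ideal E D 1"
  proof (rule facet_ideal_subset_order_ideal[OF DE])
    fix B assume "basis E indep B"
    with dep have "B \<inter> D \<noteq> {}" using not_dual_indep_iff[OF DE] by blast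
    then show "1 \<le> card (B \<inter> D)" using finD by (simp add: Suc_le_eq card_gt_0_iff)
  qed
  have "Q = order_ideal E D 1"
    if Q: "primeideal Q (poly_ring E)" "facet_ideal E indep \<subseteq> Q" "Q \<subseteq> order_ideal E D 1"
    for Q :: "('e, 'k) mpoly set"
  proof
    have idQ: "ideal Q (poly_ring E)" using Q(1) by (rule primeideal.axioms)
    let ?V = "{e \<in> E. poly_var e \<in> Q}"
    have "?V \<subseteq> D"
    proof clarify
      fix e assume "e \<in> E" "poly_var e \<in> Q"
      with Q(3) have "(poly_var e :: ('e, 'k) mpoly) \<in> order_ideal E D 1" by blast
      then have "1 \<le> deg_on D (Poly_Mapping.single e 1)" by (simp add: order_ideal_def poly_var_def)
      then have "\<exists>x\<in>D. Poly_Mapping.lookup (Poly_Mapping.single e (1::nat)) x \<noteq> 0"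
        unfolding deg_on_def by (metis not_one_le_zero sum.neutral)
      then show "e \<in> D" by (auto simp: lookup_single when_def split: if_splits)
    qed
    moreover have "\<not> dual_indep E indep ?V"
      using prime_vars_meet_basis[OF Q(1,2)] not_dual_indep_iff[of ?V] by auto
    ultimately have V: "?V = D" using ind by blast
    show "order_ideal E D 1 \<subseteq> Q"
    proof
      fix p :: "('e, 'k) mpoly" assume p: "p \<in> order_ideal E D 1"
      show "p \<in> Q"
      proof (rule ideal_memI_monoms[OF idQ])
        fix m assume m: "m \<in> Poly_Mapping.keys p"
        with p have "deg_on D m \<noteq> 0" and mE: "Poly_Mapping.keys m \<subseteq> E"
          by (auto simp: order_ideal_def poly_ring_carrier_iff)
        then obtain e where e: "e \<in> D" "Poly_Mapping.lookup m e \<noteq> 0"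
          unfolding deg_on_def by (meson sum.not_neutral_contains_not_neutral)
        have eQ: "monom (Poly_Mapping.single e 1) \<in> Q" using e(1) V by (auto simp: poly_var_def)
        show "monom m \<in> Q"
          by (rule ideal_monom_dvd[OF idQ eQ _ mE]) (use e(2) in \<open>auto simp: lookup_single when_def\<close>)
      qed
    qed
  qed (rule Q(3))
  then show ?thesis
    using sub prime_order_ideal[OF finite_ground DE] by (auto simp: minimal_primes_def)
qed

lemma symbolic_power_subset_order_ideal:
  assumes D: "circuit E (dual_indep E indep) D"
  shows "symbolic_power (poly_ring E) (facet_ideal E indep :: ('e, 'k::field) mpoly set) s
    \<subseteq> order_ideal E D s"
  using cocircuit_minimal_prime[OF D] pow_subset_order_ideal[of "order_ideal E D 1" E D 1 s]
  unfolding symbolic_power_def by force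

text \<open>
  The variables in a minimal prime meet every basis, and a monomial of degree at least
  \<open>s\<close> in these variables lies in the \<open>s\<close>-th power of the prime.
\<close>

lemma monom_symbolic_powerI:
  assumes m: "Poly_Mapping.keys m \<subseteq> E"
    and meet: "\<And>V. V \<subseteq> E \<Longrightarrow> (\<And>B. basis E indep B \<Longrightarrow> B \<inter> V \<noteq> {}) \<Longrightarrow> s \<le> deg_on V m"
  shows "monom m \<in> symbolic_power (poly_ring E) (facet_ideal E indep :: ('e, 'k::field) mpoly set) s"
proof -
  have "monom m \<in> P [^]\<^bsub>ideals_set (poly_ring E)\<^esub> s"
    if P: "P \<in> minimal_primes (poly_ring E) (facet_ideal E indep)" for P :: "('e, 'k) mpoly set"
  proof (rule monom_pow_of_vars[of "{e \<in> E. poly_var e \<in> P}" P m E])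
    from P have prime: "primeideal P (poly_ring E)" "facet_ideal E indep \<subseteq> P"
      by (auto simp: minimal_primes_def)
    show "s \<le> deg_on {e \<in> E. poly_var e \<in> P} m"
      using prime_vars_meet_basis[OF prime] by (intro meet) auto
  qed (use m finite_ground in auto)
  then show ?thesis using monom_carrier[OF m] by (auto simp: symbolic_power_def)
qed

lemma monom_facet_ideal_powI:
  assumes m: "Poly_Mapping.keys m \<subseteq> E"
    and B: "\<And>i. i < r \<Longrightarrow> basis E indep (B i)"
      "\<And>e. card {i. i < r \<and> e \<in> B i} \<le> Poly_Mapping.lookup m e"
  shows "(monom m :: ('e, 'k::field) mpoly)
    \<in> facet_ideal E indep [^]\<^bsub>ideals_set (poly_ring E)\<^esub> (r::nat)"
proof (rule ideal_monom_dvd[OF cring.ideal_pow_ideal[OF poly_ring_cring ideal_facet_ideal]])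
  show "(monom (\<Sum>i<r. exponent (B i) (\<lambda>_. 1)) :: ('e, 'k) mpoly)
      \<in> facet_ideal E indep [^]\<^bsub>ideals_set (poly_ring E)\<^esub> r"
    using B(1) by (intro monom_prod_pow basis_monom_facet_ideal)
  fix e
  have "Poly_Mapping.lookup (\<Sum>i<r. exponent (B i) (\<lambda>_. 1)) e = (\<Sum>i<r. if e \<in> B i then 1 else 0)"
    unfolding lookup_sum using B(1) basis_finite by (intro sum.cong) (auto simp: lookup_exponent)
  also have "\<dots> = card {i. i < r \<and> e \<in> B i}"
    by (simp add: sum.If_cases Int_def)
  finally show "Poly_Mapping.lookup (\<Sum>i<r. exponent (B i) (\<lambda>_. 1)) e \<le> Poly_Mapping.lookup m e"
    using B(2) by simp
qed (rule m)

lemma cocircumference_pos: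
  assumes "0 < rk E"
  shows "0 < circumference E (dual_indep E indep)"
proof -
  have "rk {} = 0" using rk_witness[of "{}"] by force
  with assms have "rk {} < rk E" by simp
  then obtain D where D: "circuit E (dual_indep E indep) D"
    by (rule cocircuit_off[OF empty_subsetI])
  then have "finite D" using finite_ground finite_subset by (auto simp: circuit_def)
  with D have "0 < card D" using cocircuit_nonempty by (simp add: card_gt_0_iff)
  then show ?thesis using card_circuit_le[OF D] by simp
qed

text \<open>
  The exponent of a monomial in the symbolic power gives every cocircuit weight at least \<open>s\<close>.
  The covering bound for \<open>M / A\<close>, of rank \<open>k' \<le> k\<close>, combined with
  \<open>k' (k + c - 1) \<le> k (k' + c - 1)\<close> and the assumed ratio, yields weight at least \<open>r k'\<close>
  outside each \<open>A\<close>.  This is the condition for packing \<open>r\<close> bases into the exponent, so the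
  monomial is a multiple of a product of \<open>r\<close> generators.
\<close>

lemma symbolic_power_subset_pow:
  fixes k c :: nat
  defines "k \<equiv> rk E" and "c \<equiv> circumference E (dual_indep E indep)"
  assumes k: "0 < k" and ratio: "r * (k * c) \<le> s * (k + c - 1)"
  shows "symbolic_power (poly_ring E) (facet_ideal E indep :: ('e, 'k::field) mpoly set) s
    \<subseteq> facet_ideal E indep [^]\<^bsub>ideals_set (poly_ring E)\<^esub> r"
proof
  fix p :: "('e, 'k) mpoly"
  assume p: "p \<in> symbolic_power (poly_ring E) (facet_ideal E indep) s"
  have c: "0 < c" using cocircumference_pos k by (simp add: k_def c_def)
  show "p \<in> facet_ideal E indep [^]\<^bsub>ideals_set (poly_ring E)\<^esub> r"
  proof (rule ideal_memI_monoms[OF cring.ideal_pow_ideal[OF poly_ring_cring ideal_facet_ideal]])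
    fix m assume m: "m \<in> Poly_Mapping.keys p"
    have mE: "Poly_Mapping.keys m \<subseteq> E"
      using p m by (auto simp: symbolic_power_def poly_ring_carrier_iff)
    let ?a = "Poly_Mapping.lookup m"
    have cover: "s \<le> sum ?a D" if "circuit E (dual_indep E indep) D" for D
      using symbolic_power_subset_order_ideal[OF that, where s = s] p m
      by (auto simp: order_ideal_def deg_on_def)
    have "r * rk E \<le> r * rk A + sum ?a (E - A)" if A: "A \<subseteq> E" for A
    proof (cases "rk E \<le> rk A")
      case True
      then show ?thesis by (simp add: trans_le_add1)
    next
      case False
      then obtain n where n: "rk E = rk A + Suc n" using less_imp_Suc_add not_le by (metis add_Suc_right)
      have "s * (n + c) \<le> c * sum ?a (E - A)"
        using card_circuit_le cover A n unfolding c_def by (intro cocircuit_cover_bound) auto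
      then have bound: "k * (s * (n + c)) \<le> (k * c) * sum ?a (E - A)" by simp
      obtain d where d: "c = Suc d" using c gr0_implies_Suc by blast
      \<comment> \<open>The comparison of \<open>k' = n + 1\<close> with \<open>k\<close>, written without subtraction.\<close>
      have "d * Suc n \<le> d * k" using n by (simp add: k_def)
      then have "(k + c - 1) * Suc n \<le> k * (n + c)" by (simp add: d algebra_simps)
      then have "s * ((k + c - 1) * Suc n) \<le> s * (k * (n + c))" by (rule mult_le_mono2)
      moreover have "(r * (k * c)) * Suc n \<le> (s * (k + c - 1)) * Suc n"
        using ratio by (rule mult_le_mono1)
      ultimately have "(k * c) * (r * Suc n) \<le> (k * c) * sum ?a (E - A)"
        using bound by (simp only: ac_simps)
      then have "r * Suc n \<le> sum ?a (E - A)" using k c by simp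
      then show ?thesis by (simp add: n algebra_simps)
    qed
    then obtain B where "\<forall>i<r. basis E indep (B i)" "\<forall>e. card {i. i < r \<and> e \<in> B i} \<le> ?a e"
      by (rule base_packing)
    then show "monom m \<in> facet_ideal E indep [^]\<^bsub>ideals_set (poly_ring E)\<^esub> r"
      by (intro monom_facet_ideal_powI[OF mE]) auto
  qed
qed

text \<open>
  The witness is the monomial with exponent \<open>s / 2\<close>, rounded up, on the circuit \<open>C\<close> and \<open>s\<close>
  on the set \<open>A\<close> of the completion lemma for circuits.  A set meeting every basis meets
  \<open>A\<close> or contains two elements of \<open>C\<close>.  On the other hand every basis has at least
  \<open>card C - 1\<close> elements outside \<open>A\<close>, and outside \<open>A\<close> the degree of the monomial is only about
  \<open>card C * s / 2\<close>.
\<close>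

lemma symbolic_power_not_subset_pow_circuit:
  assumes C: "circuit E indep C" and ratio: "card C * (s + 1) < 2 * (card C - 1) * r"
  shows "\<not> symbolic_power (poly_ring E) (facet_ideal E indep :: ('e, 'k::field) mpoly set) s
    \<subseteq> facet_ideal E indep [^]\<^bsub>ideals_set (poly_ring E)\<^esub> r"
proof
  assume sub: "symbolic_power (poly_ring E) (facet_ideal E indep :: ('e, 'k) mpoly set) s
    \<subseteq> facet_ideal E indep [^]\<^bsub>ideals_set (poly_ring E)\<^esub> r"
  obtain A where A: "A \<subseteq> E - C" "card A + card C = Suc (rk E)"
    and "\<forall>e\<in>C. basis E indep (A \<union> (C - {e}))"
    by (rule circuit_completion[OF C])
  then have bases: "\<And>e. e \<in> C \<Longrightarrow> basis E indep (A \<union> (C - {e}))" by blast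
  have CE: "C \<subseteq> E" and "C \<noteq> {}" using C indep_empty by (auto simp: circuit_def)
  have fin: "finite A" "finite C" using A(1) CE finite_ground finite_subset by blast+
  define a where "a = (\<lambda>e. if e \<in> C then (s + 1) div 2 else s)"
  define m where "m = exponent (A \<union> C) a"
  have mE: "Poly_Mapping.keys m \<subseteq> E"
    using keys_exponent[of "A \<union> C" a] fin A(1) CE by (auto simp: m_def)
  have "monom m \<in> symbolic_power (poly_ring E) (facet_ideal E indep :: ('e, 'k) mpoly set) s"
  proof (rule monom_symbolic_powerI[OF mE])
    fix V assume V: "V \<subseteq> E" "\<And>B. basis E indep B \<Longrightarrow> B \<inter> V \<noteq> {}"
    have finV: "finite V" using V(1) finite_ground finite_subset by blast
    show "s \<le> deg_on V m"
    proof (cases "A \<inter> V = {}")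
      case False
      then obtain e where e: "e \<in> A" "e \<in> V" by blast
      then have "Poly_Mapping.lookup m e = s"
        using A(1) fin by (auto simp: m_def a_def lookup_exponent)
      then show ?thesis using lookup_le_deg_on[OF finV e(2), of m] by simp
    next
      case True
      obtain z where "z \<in> C" using \<open>C \<noteq> {}\<close> by blast
      with V(2)[OF bases] True obtain e where e: "e \<in> C" "e \<in> V" by blast
      with V(2)[OF bases] True obtain f where f: "f \<in> C" "f \<in> V" "f \<noteq> e" by blast
      have "s \<le> (\<Sum>x\<in>{e, f}. Poly_Mapping.lookup m x)"
        using e f fin by (simp add: m_def a_def lookup_exponent)
      also have "\<dots> \<le> deg_on V m"
        unfolding deg_on_def using e f finV by (intro sum_mono2) auto
      finally show ?thesis .
    qed
  qed
  with sub have "(monom m :: ('e, 'k) mpoly) \<in> facet_ideal E indep [^]\<^bsub>ideals_set (poly_ring E)\<^esub> r"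
    by blast
  moreover have "(facet_ideal E indep :: ('e, 'k) mpoly set) \<subseteq> order_ideal E (E - A) (card C - 1)"
  proof (rule facet_ideal_subset_order_ideal)
    fix B assume B: "basis E indep B"
    have "card B \<le> card (B \<inter> (E - A)) + card A"
    proof -
      have "card B \<le> card ((B \<inter> (E - A)) \<union> A)"
        using basis_ground[OF B] fin finite_ground by (intro card_mono) auto
      then show ?thesis using card_Un_le le_trans by blast
    qed
    then show "card C - 1 \<le> card (B \<inter> (E - A))" using A(2) B basis_iff by auto
  qed blast
  ultimately have "(monom m :: ('e, 'k) mpoly) \<in> order_ideal E (E - A) (r * (card C - 1))"
    using pow_subset_order_ideal by blast
  then have "r * (card C - 1) \<le> deg_on (E - A) m" by (simp add: order_ideal_def)
  also have "\<dots> = sum a ((A \<union> C) \<inter> (E - A))"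
    using fin finite_ground by (simp add: m_def deg_on_exponent)
  also have "(A \<union> C) \<inter> (E - A) = C" using A(1) CE by blast
  also have "sum a C = card C * ((s + 1) div 2)" by (simp add: a_def)
  finally have "2 * (card C - 1) * r \<le> card C * (2 * ((s + 1) div 2))"
    by (simp add: mult.commute mult.left_commute)
  also have "\<dots> \<le> card C * (s + 1)" by (intro mult_le_mono2) simp
  finally show False using ratio by simp
qed

text \<open>
  The \<open>s\<close>-th power of a generator has too small a degree.
\<close>

lemma symbolic_power_not_subset_higher_pow:
  assumes "0 < rk E" "s < r"
  shows "\<not> symbolic_power (poly_ring E) (facet_ideal E indep :: ('e, 'k::field) mpoly set) s
    \<subseteq> facet_ideal E indep [^]\<^bsub>ideals_set (poly_ring E)\<^esub> r"
proof
  assume sub: "symbolic_power (poly_ring E) (facet_ideal E indep :: ('e, 'k) mpoly set) s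
    \<subseteq> facet_ideal E indep [^]\<^bsub>ideals_set (poly_ring E)\<^esub> r"
  obtain B where B: "basis E indep B" using basis_in_full_rank[of E] by blast
  define m where "m = exponent B (\<lambda>_. s)"
  have mE: "Poly_Mapping.keys m \<subseteq> E"
    using keys_exponent[OF basis_finite[OF B]] basis_ground[OF B] by (auto simp: m_def)
  have "monom m \<in> symbolic_power (poly_ring E) (facet_ideal E indep :: ('e, 'k) mpoly set) s"
  proof (rule monom_symbolic_powerI[OF mE])
    fix V assume V: "V \<subseteq> E" "\<And>B. basis E indep B \<Longrightarrow> B \<inter> V \<noteq> {}"
    then obtain e where e: "e \<in> B" "e \<in> V" using B by blast
    have "finite V" using V(1) finite_ground finite_subset by blast
    from lookup_le_deg_on[OF this e(2), of m] show "s \<le> deg_on V m"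
      using e basis_finite[OF B] by (simp add: m_def lookup_exponent)
  qed
  moreover have "(facet_ideal E indep :: ('e, 'k) mpoly set) \<subseteq> order_ideal E E (rk E)"
  proof (rule facet_ideal_subset_order_ideal)
    fix B assume "basis E indep B"
    then show "rk E \<le> card (B \<inter> E)" using basis_ground basis_iff by (simp add: Int_absorb2)
  qed simp
  ultimately have "(monom m :: ('e, 'k) mpoly) \<in> order_ideal E E (r * rk E)"
    using sub pow_subset_order_ideal by blast
  then have "r * rk E \<le> s * rk E"
    using B basis_iff basis_finite[OF B] basis_ground[OF B] finite_ground
    by (simp add: order_ideal_def m_def deg_on_exponent Int_absorb2 mult.commute)
  then show False using assms by simp
qed

end

section \<open>Bounds on the asymptotic resurgence\<close>

theorem theorem4p6:
  fixes E :: "'e set" and indep :: "'e set \<Rightarrow> bool"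
  assumes "matroid E indep"
    and "matroid_rank E indep < card E"
    and "1 \<le> matroid_rank E indep"
  shows "ereal (2 - 2 / real (circumference E indep))
      \<le> asymptotic_resurgence (poly_ring E :: ('e, 'k::field) mpoly ring) (facet_ideal E indep)
    \<and> asymptotic_resurgence (poly_ring E :: ('e, 'k::field) mpoly ring) (facet_ideal E indep)
      \<le> ereal (real (matroid_rank E indep) * real (circumference E (dual_indep E indep)) /
          (real (matroid_rank E indep) + real (circumference E (dual_indep E indep)) - 1))"
proof
  interpret matroid E indep by fact
  let ?R = "poly_ring E :: ('e, 'k) mpoly ring" and ?I = "facet_ideal E indep :: ('e, 'k) mpoly set"
  let ?\<rho> = "asymptotic_resurgence ?R ?I"
  define n where "n = circumference E indep"
  define c where "c = circumference E (dual_indep E indep)"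
  define k where "k = matroid_rank E indep"
  have k: "0 < k" "k = rk E" using assms(3) by (simp_all add: k_def matroid_rank_eq)
  have ge: "ereal (real s / real r) \<le> ?\<rho>"
    if "0 < s" "0 < r" "\<And>t. t > N \<Longrightarrow>
      \<not> symbolic_power ?R ?I (s * t) \<subseteq> ?I [^]\<^bsub>ideals_set ?R\<^esub> (r * t)" for s r N
    unfolding asymptotic_resurgence_def
  proof (intro Sup_upper CollectI exI conjI)
    show "\<forall>\<^sub>F t in sequentially.
        \<not> symbolic_power ?R ?I (s * t) \<subseteq> ?I [^]\<^bsub>ideals_set ?R\<^esub> (r * t)"
      using eventually_gt_at_top[of N] by (rule eventually_mono) (rule that(3))
  qed (use that in auto)
  show "ereal (2 - 2 / real (circumference E indep)) \<le> ?\<rho>"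
  proof -
    have "\<not> indep E"
      using assms(2) card_le_rk[of E E] by (auto simp: matroid_rank_eq)
    then have "{C. circuit E indep C} \<noteq> {}"
      using minimal_dependent[of E indep] by blast
    then have "n \<in> card ` {C. circuit E indep C}"
      unfolding n_def circumference_def using finite_circuits by (intro Max_in) auto
    then obtain C where C: "circuit E indep C" "card C = n" by blast
    have "C \<noteq> {}" "finite C"
      using C indep_empty finite_ground finite_subset by (auto simp: circuit_def)
    then have "0 < card C" by (simp add: card_gt_0_iff)
    then have "0 < n" using C(2) by simp
    then consider "n = 1" | "2 \<le> n" by linarith
    then show ?thesis
    proof cases
      case 1
      \<comment> \<open>The bound is \<open>0\<close>; any element of the set shows that its supremum is not \<open>-\<infinity>\<close>.\<close>
      have "ereal (real 1 / real 2) \<le> ?\<rho>"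
      proof (rule ge)
        show "\<not> symbolic_power ?R ?I (1 * t) \<subseteq> ?I [^]\<^bsub>ideals_set ?R\<^esub> (2 * t)" if "0 < t" for t
          using that k by (intro symbolic_power_not_subset_higher_pow) auto
      qed auto
      moreover have "ereal (2 - 2 / real n) \<le> ereal (real 1 / real 2)" using 1 by simp
      ultimately show ?thesis unfolding n_def by (rule order_trans[rotated])
    next
      case 2
      show ?thesis
      proof (rule ereal_le_epsilon2)
        fix \<epsilon> :: real assume "0 < \<epsilon>"
        then obtain j where j: "0 < j" "1 / real j < \<epsilon>"
          using ex_inverse_of_nat_less by (metis inverse_eq_divide)
        \<comment> \<open>These make \<open>s / r\<close> equal to \<open>2 - 2 / n - 1 / (n j)\<close>.\<close>
        define s where "s = 2 * (n - 1) * j - 1"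
        define r where "r = n * j"
        have "2 \<le> 2 * (n - 1) * j" using 2 j by (cases "n - 1"; cases j) auto
        then have s: "s + 1 = 2 * (n - 1) * j" "0 < s" unfolding s_def by linarith+
        have r: "0 < r" using 2 j by (simp add: r_def)
        have "ereal (real s / real r) \<le> ?\<rho>"
        proof (rule ge[OF s(2) r])
          fix t :: nat assume t: "1 < t"
          have "n * (s * t + 1) < n * (s * t + t)" using t 2 by (intro mult_strict_left_mono) auto
          also have "\<dots> = n * (s + 1) * t" by (simp add: algebra_simps)
          also have "\<dots> = 2 * (n - 1) * (r * t)" unfolding s(1) r_def by (simp only: ac_simps)
          finally show "\<not> symbolic_power ?R ?I (s * t) \<subseteq> ?I [^]\<^bsub>ideals_set ?R\<^esub> (r * t)"
            by (intro symbolic_power_not_subset_pow_circuit[OF C(1)]) (simp only: C(2))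
        qed
        moreover have "2 - 2 / real n \<le> real s / real r + \<epsilon>"
        proof -
          have "real s + 1 = 2 * (real n - 1) * real j"
            using arg_cong[OF s(1), of real] 2 by (simp add: of_nat_diff)
          then have "real s = 2 * (real n - 1) * real j - 1" by simp
          then have "real s / real r = (2 * (real n - 1) * real j - 1) / (real n * real j)"
            by (simp only: r_def of_nat_mult)
          also have "\<dots> = 2 - 2 / real n - 1 / (real n * real j)"
            using 2 j(1) by (simp add: field_simps)
          finally have "real s / real r = 2 - 2 / real n - 1 / (real n * real j)" .
          moreover have "1 / (real n * real j) \<le> 1 / real j"
            using 2 j by (intro divide_left_mono) auto
          ultimately show ?thesis using j(2) by linarith
        qed
        then have "ereal (2 - 2 / real n) \<le> ereal (real s / real r) + ereal \<epsilon>" by simp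
        ultimately show "ereal (2 - 2 / real (circumference E indep)) \<le> ?\<rho> + ereal \<epsilon>"
          unfolding n_def by (meson add_right_mono order_trans)
      qed
    qed
  qed
  show "?\<rho> \<le> ereal (real (matroid_rank E indep) * real (circumference E (dual_indep E indep)) /
      (real (matroid_rank E indep) + real (circumference E (dual_indep E indep)) - 1))"
    unfolding asymptotic_resurgence_def
  proof (rule Sup_least, clarify)
    fix s r :: nat
    assume sr: "0 < s" "0 < r"
      and ev: "\<forall>\<^sub>F t in sequentially.
        \<not> symbolic_power ?R ?I (s * t) \<subseteq> ?I [^]\<^bsub>ideals_set ?R\<^esub> (r * t)"
    have c: "0 < c" using cocircumference_pos k by (simp add: c_def)
    have "\<not> r * (k * c) \<le> s * (k + c - 1)"
    proof
      assume le: "r * (k * c) \<le> s * (k + c - 1)"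
      have "symbolic_power ?R ?I (s * t) \<subseteq> ?I [^]\<^bsub>ideals_set ?R\<^esub> (r * t)" for t
      proof (rule symbolic_power_subset_pow)
        have "(r * (k * c)) * t \<le> (s * (k + c - 1)) * t" using le by (rule mult_le_mono1)
        then show "(r * t) * (rk E * circumference E (dual_indep E indep))
            \<le> (s * t) * (rk E + circumference E (dual_indep E indep) - 1)"
          by (simp only: k(2) c_def ac_simps)
      qed (use k in simp)
      with ev show False by simp
    qed
    then have "s * (k + c - 1) < r * (k * c)" by simp
    then have "real (s * (k + c - 1)) < real (r * (k * c))" by (simp only: of_nat_less_iff)
    then have "real s * (real k + real c - 1) < real r * (real k * real c)"
      using k c by (simp add: of_nat_diff)
    then have "real s / real r \<le> real k * real c / (real k + real c - 1)"
      using sr k c by (simp add: field_simps)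
    then show "ereal (real s / real r) \<le> ereal (real (matroid_rank E indep) *
        real (circumference E (dual_indep E indep)) /
        (real (matroid_rank E indep) + real (circumference E (dual_indep E indep)) - 1))"
      by (simp add: k_def c_def)
  qed
qed

end
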